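(* Let $\ket{\Psi}_{AB}$ be a bipartite pure state. For an SLOCC protocol $\ket{\Psi}_{AB}\to\{p_m,\ket{\Psi_m}_{AB}\}$ and $x\ge0$ write $P(\Delta E_\alpha\ge x)=\sum_{m:\,E_\alpha(\Psi_m)-E_\alpha(\Psi)\ge x}p_m$, and similarly $P(\Delta E_S\ge x)$ with $E_S$ in place of $E_\alpha$. (a) For every $0<\alpha<1$, every SLOCC protocol applied to $\ket{\Psi}_{AB}$ and every $x\ge 0$, $$P(\Delta E_\alpha\ge x)\le e^{-\left(\frac{1-\alpha}{\alpha}\right)x}.$$ (b) There exist constants $K>0$ and $k>0$ (which may depend on $\Psi$) such that for every SLOCC protocol applied to $\ket{\Psi}_{AB}$ and every $x\ge0$, $$P(\Delta E_S\ge x)\le K e^{-kx}.$$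
   Context: All Hilbert spaces are finite-dimensional; $\log$ is the natural logarithm. For a unit vector $\ket{\Psi}_{AB}\in\mathcal H_A\otimes\mathcal H_B$ put $\rho_B=\mathrm{Tr}_A\ket{\Psi}\bra{\Psi}$. For $\alpha>0$, $\alpha\ne1$, the Rényi entanglement entropy (REE) is $E_\alpha(\Psi)=\frac{1}{1-\alpha}\log\mathrm{Tr}[\rho_B^\alpha]$; the entanglement entropy is $E_S(\Psi)=-\mathrm{Tr}[\rho_B\log\rho_B]$. SLOCC protocol on pure states: a finite number of rounds; in each round one of the two parties (chosen depending on previous outcomes) applies a local measurement, i.e. a finite family of Kraus operators $\{K_j\}$ on its own system (possibly with a different finite-dimensional output space) with $\sum_jK_j^\dagger K_j=\mathbb 1$, which may depend on all previously obtained (classically communicated) outcomes. A sequence $m$ of outcomes corresponds to a product operator $A_m\otimes B_m$; it occurs with probability $p_m=\|(A_m\otimes B_m)\ket{\Psi}\|^2$, and (if $p_m>0$) the outcome state is $\ket{\Psi_m}=(A_m\otimes B_m)\ket{\Psi}/\sqrt{p_m}$. Thus $\sum_mp_m=1$, and one writes $\ket{\Psi}\to\{p_m,\ket{\Psi_m}\}$ (outcomes with $p_m=0$ are discarded). *)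

theory Defs
  imports Complex_Main "Jordan_Normal_Form.Schur_Decomposition"
begin

section \<open>Bipartite pure states\<close>

text \<open>
  Hilbert spaces are coordinate spaces \<open>\<complex>\<^sup>d\<close>. The basis vector \<open>e\<^sub>a \<otimes> e\<^sub>b\<close> of
  \<open>\<complex>\<^sup>m \<otimes> \<complex>\<^sup>n\<close> has index \<open>a * n + b\<close> in \<open>\<complex>\<^sup>m\<^sup>n\<close>; the functions \<open>kron\<close> and
  \<open>ptrace_A\<close> follow this convention.
\<close>

definition vnorm :: "complex vec \<Rightarrow> real" where
  "vnorm v = sqrt (Re (v \<bullet>c v))"

definition pure_state :: "nat \<Rightarrow> nat \<Rightarrow> complex vec \<Rightarrow> bool" where
  "pure_state dA dB \<Psi> \<longleftrightarrow> \<Psi> \<in> carrier_vec (dA * dB) \<and> vnorm \<Psi> = 1"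

definition kron :: "complex mat \<Rightarrow> complex mat \<Rightarrow> complex mat" where
  "kron A B = mat (dim_row A * dim_row B) (dim_col A * dim_col B)
     (\<lambda>(i, j). A $$ (i div dim_row B, j div dim_col B) * B $$ (i mod dim_row B, j mod dim_col B))"

definition ketbra :: "complex vec \<Rightarrow> complex mat" where
  "ketbra \<Psi> = mat (dim_vec \<Psi>) (dim_vec \<Psi>) (\<lambda>(i, j). \<Psi> $ i * cnj (\<Psi> $ j))"

definition ptrace_A :: "nat \<Rightarrow> nat \<Rightarrow> complex mat \<Rightarrow> complex mat" where
  "ptrace_A dA dB \<rho> = mat dB dB (\<lambda>(i, j). \<Sum>a<dA. \<rho> $$ (a * dB + i, a * dB + j))"

definition reduced_B :: "nat \<Rightarrow> nat \<Rightarrow> complex vec \<Rightarrow> complex mat" where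
  "reduced_B dA dB \<Psi> = ptrace_A dA dB (ketbra \<Psi>)"

section \<open>Entanglement entropies\<close>

definition mat_trace :: "complex mat \<Rightarrow> complex" where
  "mat_trace M = (\<Sum>i<dim_row M. M $$ (i, i))"

text \<open>
  \<open>is_mat_fun f M N\<close>: there is a spectral decomposition \<open>M = U diag(d) U\<^sup>\<dagger>\<close> with \<open>U\<close> unitary
  and \<open>d\<close> real, and \<open>N = U diag(f d) U\<^sup>\<dagger>\<close>. For Hermitian \<open>M\<close> such an \<open>N\<close> exists and does not
  depend on the decomposition, so \<open>mat_fun f M\<close> is the usual functional calculus \<open>f(M)\<close>;
  for other \<open>M\<close> it is unspecified.
\<close>

definition is_mat_fun :: "(real \<Rightarrow> real) \<Rightarrow> complex mat \<Rightarrow> complex mat \<Rightarrow> bool" where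
  "is_mat_fun f M N \<longleftrightarrow>
     (\<exists>n U d. U \<in> carrier_mat n n \<and> U * mat_adjoint U = 1\<^sub>m n \<and> mat_adjoint U * U = 1\<^sub>m n \<and>
        M = U * mat_diag n (\<lambda>i. complex_of_real (d i)) * mat_adjoint U \<and>
        N = U * mat_diag n (\<lambda>i. complex_of_real (f (d i))) * mat_adjoint U)"

definition mat_fun :: "(real \<Rightarrow> real) \<Rightarrow> complex mat \<Rightarrow> complex mat" where
  "mat_fun f M = (SOME N. is_mat_fun f M N)"

text \<open>
  On the kernel of the density matrix, \<open>0 powr \<alpha> = 0\<close> is the usual value of \<open>0\<^sup>\<alpha>\<close> for \<open>\<alpha> > 0\<close>,
  and \<open>ln 0 = 0\<close> makes \<open>\<rho> log \<rho>\<close> vanish there, in accordance with \<open>0 log 0 = 0\<close>.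
\<close>

definition renyi_ee :: "real \<Rightarrow> nat \<Rightarrow> nat \<Rightarrow> complex vec \<Rightarrow> real" where
  "renyi_ee \<alpha> dA dB \<Psi> =
     1 / (1 - \<alpha>) * ln (Re (mat_trace (mat_fun (\<lambda>t. t powr \<alpha>) (reduced_B dA dB \<Psi>))))"

definition ent_entropy :: "nat \<Rightarrow> nat \<Rightarrow> complex vec \<Rightarrow> real" where
  "ent_entropy dA dB \<Psi> =
     - Re (mat_trace (reduced_B dA dB \<Psi> * mat_fun ln (reduced_B dA dB \<Psi>)))"

section \<open>SLOCC protocols\<close>

text \<open>
  A protocol is a finite decision tree: in a round, the given party applies the listed Kraus
  operators, each paired with the protocol that is followed after the corresponding outcome.
\<close>

datatype party = Alice | Bob

datatype protocol = Halt | Round party "(complex mat \<times> protocol) list"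

definition kraus_family :: "nat \<Rightarrow> complex mat list \<Rightarrow> bool" where
  "kraus_family d Ks \<longleftrightarrow> (\<forall>K \<in> set Ks. dim_col K = d) \<and>
     foldr (\<lambda>K S. mat_adjoint K * K + S) Ks (0\<^sub>m d d) = 1\<^sub>m d"

fun valid_protocol :: "nat \<Rightarrow> nat \<Rightarrow> protocol \<Rightarrow> bool" where
  "valid_protocol dA dB Halt \<longleftrightarrow> True"
| "valid_protocol dA dB (Round Alice br) \<longleftrightarrow>
     kraus_family dA (map fst br) \<and> (\<forall>(K, P) \<in> set br. valid_protocol (dim_row K) dB P)"
| "valid_protocol dA dB (Round Bob br) \<longleftrightarrow>
     kraus_family dB (map fst br) \<and> (\<forall>(K, P) \<in> set br. valid_protocol dA (dim_row K) P)"

text \<open>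
  The operators \<open>(A\<^sub>m, B\<^sub>m)\<close>, one list entry for each complete sequence of outcomes \<open>m\<close>.
\<close>

fun outcome_ops :: "nat \<Rightarrow> nat \<Rightarrow> protocol \<Rightarrow> (complex mat \<times> complex mat) list" where
  "outcome_ops dA dB Halt = [(1\<^sub>m dA, 1\<^sub>m dB)]"
| "outcome_ops dA dB (Round Alice br) =
     concat (map (\<lambda>(K, P). map (\<lambda>(A, B). (A * K, B)) (outcome_ops (dim_row K) dB P)) br)"
| "outcome_ops dA dB (Round Bob br) =
     concat (map (\<lambda>(K, P). map (\<lambda>(A, B). (A, B * K)) (outcome_ops dA (dim_row K) P)) br)"

definition outcome_prob :: "complex vec \<Rightarrow> complex mat \<times> complex mat \<Rightarrow> real" where
  "outcome_prob \<Psi> = (\<lambda>(A, B). (vnorm (kron A B *\<^sub>v \<Psi>))\<^sup>2)"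

definition outcome_state :: "complex vec \<Rightarrow> complex mat \<times> complex mat \<Rightarrow> complex vec" where
  "outcome_state \<Psi> =
     (\<lambda>(A, B). complex_of_real (1 / sqrt (outcome_prob \<Psi> (A, B))) \<cdot>\<^sub>v (kron A B *\<^sub>v \<Psi>))"

text \<open>
  \<open>prob_gain E dA dB P \<Psi> x\<close> is \<open>P(\<Delta>E \<ge> x)\<close> for an entanglement measure \<open>E\<close>, which takes
  the local dimensions as arguments because they may change in the course of the protocol.
\<close>

definition prob_gain ::
  "(nat \<Rightarrow> nat \<Rightarrow> complex vec \<Rightarrow> real) \<Rightarrow> nat \<Rightarrow> nat \<Rightarrow> protocol \<Rightarrow> complex vec \<Rightarrow> real \<Rightarrow> real" where
  "prob_gain E dA dB P \<Psi> x =
     (let ops = outcome_ops dA dB P;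
          p = (\<lambda>m. outcome_prob \<Psi> (ops ! m));
          E_out = (\<lambda>m. E (dim_row (fst (ops ! m))) (dim_row (snd (ops ! m))) (outcome_state \<Psi> (ops ! m)))
      in \<Sum>m | m < length ops \<and> p m > 0 \<and> E_out m - E dA dB \<Psi> \<ge> x. p m)"

end

theory Submission
  imports Defs "Jordan_Normal_Form.Spectral_Radius"
begin

text \<open>
  Write the state as its \<open>dB \<times> dA\<close> coefficient matrix \<open>X\<close>, so that \<open>\<rho>\<^sub>B = X X\<^sup>\<dagger>\<close> and an outcome
  \<open>A \<otimes> B\<close> sends \<open>X\<close> to \<open>B X A\<^sup>T\<close>. For \<open>0 < \<alpha> < 1\<close> the quantity \<open>N(X) = (Tr (X X\<^sup>\<dagger>)\<^sup>\<alpha>)\<^bsup>1/\<alpha>\<^esup>\<close>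
  is homogeneous of degree one in \<open>\<rho>\<^sub>B\<close> and does not increase on average. Indeed, in an eigenbasis of
  \<open>\<rho> = \<Sum>\<^sub>j \<rho>\<^sub>j\<close> the diagonals of the \<open>\<rho>\<^sub>j\<close> add up to the spectrum of \<open>\<rho>\<close>; the reverse Minkowski inequality
  applies to these diagonals, and by concavity of \<open>t\<^sup>\<alpha>\<close> each diagonal has larger \<open>\<alpha>\<close>-quasinorm than the
  spectrum of \<open>\<rho>\<^sub>j\<close>. Measurements of the other party reduce to this case since \<open>N(X) = N(X\<^sup>\<dagger>)\<close>.
  For unit vectors \<open>N = exp ((1 - \<alpha>)/\<alpha> E\<^sub>\<alpha>)\<close>, so (a) is Markov's inequality for \<open>N\<close>. Part (b) follows
  from (a) at \<open>\<alpha> = 1/2\<close> and \<open>E\<^sub>S \<le> E\<^sub>\<alpha>\<close>, with \<open>k = 1\<close> and \<open>K = exp (E\<^bsub>1/2\<^esub>(\<Psi>) - E\<^sub>S(\<Psi>))\<close>.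
\<close>

section \<open>Unitary diagonalisation of Hermitian matrices\<close>

lemma mat_adjoint_dim [simp]:
  "dim_row (mat_adjoint A) = dim_col A" "dim_col (mat_adjoint A) = dim_row A"
  by (auto simp: mat_adjoint_def)

lemma mat_adjoint_carrier [simp, intro]:
  "A \<in> carrier_mat n m \<Longrightarrow> mat_adjoint A \<in> carrier_mat m n"
  by (rule carrier_matI) auto

lemma mat_adjoint_index [simp]:
  fixes A :: "complex mat"
  assumes "i < dim_col A" "j < dim_row A"
  shows "mat_adjoint A $$ (i, j) = cnj (A $$ (j, i))"
  using assms by (simp add: mat_adjoint_def mat_of_rows_index conjugate_complex_def)

lemma mat_adjoint_adjoint [simp]:
  fixes A :: "complex mat"
  shows "mat_adjoint (mat_adjoint A) = A"
  by (rule eq_matI) auto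

lemma mat_adjoint_mult:
  fixes A B :: "complex mat"
  assumes "A \<in> carrier_mat n m" "B \<in> carrier_mat m k"
  shows "mat_adjoint (A * B) = mat_adjoint B * mat_adjoint A"
  using assms by (intro eq_matI) (auto simp: scalar_prod_def ac_simps)

lemma index_mult_mat_sum:
  assumes "A \<in> carrier_mat n m" "B \<in> carrier_mat m k" "i < n" "j < k"
  shows "(A * B) $$ (i, j) = (\<Sum>l<m. A $$ (i, l) * B $$ (l, j))"
  using assms by (simp add: scalar_prod_def lessThan_atLeast0)

lemma mult_adjoint_diag:
  fixes A :: "complex mat"
  assumes "A \<in> carrier_mat n m" "i < n"
  shows "(A * mat_adjoint A) $$ (i, i) = complex_of_real (\<Sum>l<m. (cmod (A $$ (i, l)))\<^sup>2)"
  using assms by (subst index_mult_mat_sum[of _ n m _ n]) (auto intro!: sum.cong simp: complex_norm_square simp del: of_real_power)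

section \<open>Unitary matrices and spectral decompositions\<close>

definition unitary_mat :: "nat \<Rightarrow> complex mat \<Rightarrow> bool" where
  "unitary_mat n U \<longleftrightarrow> U \<in> carrier_mat n n \<and> U * mat_adjoint U = 1\<^sub>m n \<and> mat_adjoint U * U = 1\<^sub>m n"

lemma unitary_matI:
  assumes "U \<in> carrier_mat n n" "mat_adjoint U * U = 1\<^sub>m n"
  shows "unitary_mat n U"
  using assms mat_mult_left_right_inverse[of "mat_adjoint U" n U] by (auto simp: unitary_mat_def)

lemma unitary_mat_mult:
  assumes "unitary_mat n U" "unitary_mat n V"
  shows "unitary_mat n (U * V)"
proof (rule unitary_matI)
  have c [simp]: "U \<in> carrier_mat n n" "V \<in> carrier_mat n n" using assms by (auto simp: unitary_mat_def)
  show UV [simp]: "U * V \<in> carrier_mat n n" by (rule mult_carrier_mat[of _ n n]) auto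
  have "mat_adjoint (U * V) * (U * V) = mat_adjoint V * (mat_adjoint U * (U * V))"
    by (subst mat_adjoint_mult[of _ n n _ n]) (auto intro!: assoc_mult_mat[of _ n n _ n _ n])
  also have "mat_adjoint U * (U * V) = (mat_adjoint U * U) * V"
    by (auto intro!: assoc_mult_mat[of _ n n _ n _ n, symmetric])
  also have "mat_adjoint V * \<dots> = 1\<^sub>m n" using assms by (simp add: unitary_mat_def left_mult_one_mat[of _ n n])
  finally show "mat_adjoint (U * V) * (U * V) = 1\<^sub>m n" .
qed

lemma unitary_mat_adjoint: "unitary_mat n U \<Longrightarrow> unitary_mat n (mat_adjoint U)"
  by (auto simp: unitary_mat_def)

lemma unitary_mat_row:
  assumes "unitary_mat n U" "i < n"
  shows "(\<Sum>j<n. (cmod (U $$ (i, j)))\<^sup>2) = 1"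
proof -
  have "complex_of_real (\<Sum>j<n. (cmod (U $$ (i, j)))\<^sup>2) = 1"
    using assms mult_adjoint_diag[of U n n i] by (auto simp: unitary_mat_def)
  then show ?thesis using of_real_eq_1_iff by blast
qed

lemma unitary_mat_col:
  assumes "unitary_mat n U" "j < n"
  shows "(\<Sum>i<n. (cmod (U $$ (i, j)))\<^sup>2) = 1"
proof -
  have "U \<in> carrier_mat n n" using assms by (auto simp: unitary_mat_def)
  then show ?thesis using unitary_mat_row[OF unitary_mat_adjoint[OF assms(1)] assms(2)] assms(2)
    by (simp cong: sum.cong_simp)
qed

text \<open>The decomposition over which \<open>is_mat_fun\<close> quantifies, with the dimension as
  a parameter. Only the values of \<open>d\<close> below \<open>n\<close> matter, and they carry no
  order, so \<open>U\<close> and \<open>d\<close> are not determined by \<open>M\<close>.\<close>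

definition spectral :: "nat \<Rightarrow> complex mat \<Rightarrow> complex mat \<Rightarrow> (nat \<Rightarrow> real) \<Rightarrow> bool" where
  "spectral n M U d \<longleftrightarrow> unitary_mat n U \<and>
     M = U * mat_diag n (\<lambda>i. complex_of_real (d i)) * mat_adjoint U"

lemma cscalar_self_pos:
  fixes v :: "complex vec"
  assumes "v \<in> carrier_vec n" "v \<noteq> 0\<^sub>v n"
  shows "v \<bullet>c v = complex_of_real (Re (v \<bullet>c v))" "Re (v \<bullet>c v) > 0"
  using conjugate_square_greater_0_vec[OF assms(1)] assms(2)
  by (auto simp: less_complex_def complex_eq_iff)

text \<open>Complete \<open>v\<close> to a basis; Gram-Schmidt keeps \<open>v\<close> as the first
  vector. Its output is orthogonal but not normalised, hence the division by the lengths
  \<open>a j\<close> and the factor \<open>c\<close>.\<close>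

lemma unitary_first_column:
  fixes v :: "complex vec"
  assumes v: "v \<in> carrier_vec n" and v0: "v \<noteq> 0\<^sub>v n"
  shows "\<exists>W c. unitary_mat n W \<and> c \<noteq> 0 \<and> col W 0 = c \<cdot>\<^sub>v v"
proof -
  have n: "n \<noteq> 0" using v v0 by (metis carrier_vecD eq_vecI index_zero_vec(2) less_nat_zero_code)
  define b where "b = basis_completion v"
  define ws where "ws = gram_schmidt n b"
  interpret cof_vec_space n "TYPE(complex)" .
  from basis_completion[OF v v0, folded b_def]
  have span_b: "span (set b) = carrier_vec n" and dist_b: "distinct b"
    and indep: "\<not> lin_dep (set b)" and b: "set b \<subseteq> carrier_vec n" and hdb: "hd b = v"
    and len_b: "length b = n" by auto
  from hdb len_b n obtain vs where bv: "b = v # vs" by (cases b, auto)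
  from gram_schmidt_result[OF b dist_b indep refl, folded ws_def]
  have ws: "set ws \<subseteq> carrier_vec n" "corthogonal ws" "length ws = n"
    by (auto simp: len_b)
  from gram_schmidt_hd[OF v, of vs, folded bv] have hdws: "hd ws = v" unfolding ws_def .
  have wsi: "ws ! i \<in> carrier_vec n" if "i < n" for i using ws that by auto
  have orth: "ws ! i \<bullet>c ws ! j = 0 \<longleftrightarrow> i \<noteq> j" if "i < n" "j < n" for i j
    using corthogonalD[OF ws(2)] that ws(3) by auto
  have nz: "ws ! i \<noteq> 0\<^sub>v n" if "i < n" for i
    using orth[OF that that] conjugate_square_eq_0_vec[OF wsi[OF that]] by auto
  define a where "a i = sqrt (Re (ws ! i \<bullet>c ws ! i))" for i
  have a: "a i > 0" "ws ! i \<bullet>c ws ! i = complex_of_real ((a i)\<^sup>2)" if "i < n" for i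
    using cscalar_self_pos[OF wsi[OF that] nz[OF that]] unfolding a_def by auto
  define W where "W = mat n n (\<lambda>(i, j). ws ! j $ i / complex_of_real (a j))"
  have W: "W \<in> carrier_mat n n" by (simp add: W_def)
  have "mat_adjoint W * W = 1\<^sub>m n"
  proof (rule eq_matI)
    fix i j assume "i < dim_row (1\<^sub>m n)" "j < dim_col (1\<^sub>m n)"
    then have ij: "i < n" "j < n" by auto
    have "(mat_adjoint W * W) $$ (i, j) = (\<Sum>l<n. cnj (W $$ (l, i)) * W $$ (l, j))"
      using ij W by (subst index_mult_mat_sum[of _ n n _ n]) (auto intro!: sum.cong)
    also have "\<dots> = (\<Sum>l<n. (ws ! j $ l * cnj (ws ! i $ l)) / (a i * a j))"
      using ij by (auto intro!: sum.cong simp: W_def)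
    also have "\<dots> = (ws ! j \<bullet>c ws ! i) / (a i * a j)"
      using wsi[OF ij(1)] wsi[OF ij(2)]
      by (simp add: scalar_prod_def sum_divide_distrib conjugate_complex_def lessThan_atLeast0)
    also have "\<dots> = 1\<^sub>m n $$ (i, j)"
      using ij orth[OF ij(2,1)] a[OF ij(1)] by (auto simp: power2_eq_square)
    finally show "(mat_adjoint W * W) $$ (i, j) = 1\<^sub>m n $$ (i, j)" .
  qed (use W in auto)
  then have "unitary_mat n W" using W by (intro unitary_matI)
  moreover have "col W 0 = complex_of_real (1 / a 0) \<cdot>\<^sub>v v"
  proof (rule eq_vecI)
    fix i assume "i < dim_vec (complex_of_real (1 / a 0) \<cdot>\<^sub>v v)"
    then have "i < n" using v by auto
    moreover have "ws ! 0 = v" using hdws ws(3) n by (metis hd_conv_nth length_0_conv)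
    ultimately show "col W 0 $ i = (complex_of_real (1 / a 0) \<cdot>\<^sub>v v) $ i"
      using n v by (simp add: W_def)
  qed (use W v in auto)
  moreover have "complex_of_real (1 / a 0) \<noteq> 0" using a(1)[of 0] n by auto
  ultimately show ?thesis by blast
qed

text \<open>Deflation: in an orthonormal basis that starts with an eigenvector, the first column
  vanishes below the diagonal and, by hermiticity, the first row vanishes to its right. The
  remaining block \<open>N'\<close> is again Hermitian.\<close>

theorem hermitian_spectral:
  fixes M :: "complex mat"
  assumes "M \<in> carrier_mat n n" "mat_adjoint M = M"
  shows "\<exists>U d. spectral n M U d"
  using assms
proof (induction n arbitrary: M)
  case 0
  have "spectral 0 M (1\<^sub>m 0) (\<lambda>_. 0)"
    unfolding spectral_def unitary_mat_def using 0(1) by (intro conjI eq_matI) auto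
  then show ?case by blast
next
  case (Suc n M)
  note M = Suc.prems(1) and H = Suc.prems(2)
  from spectrum_non_empty[OF M] obtain e v where ev: "eigenvector M v e"
    by (auto simp: spectrum_def eigenvalue_def)
  then have v: "v \<in> carrier_vec (Suc n)" "v \<noteq> 0\<^sub>v (Suc n)" and Mv: "M *\<^sub>v v = e \<cdot>\<^sub>v v"
    using M by (auto simp: eigenvector_def)
  from unitary_first_column[OF v] obtain W c where W: "unitary_mat (Suc n) W"
    and c: "c \<noteq> 0" and colW: "col W 0 = c \<cdot>\<^sub>v v" by blast
  have Wc: "W \<in> carrier_mat (Suc n) (Suc n)" and WW: "W * mat_adjoint W = 1\<^sub>m (Suc n)" "mat_adjoint W * W = 1\<^sub>m (Suc n)"
    using W by (auto simp: unitary_mat_def)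
  define N where "N = mat_adjoint W * (M * W)"
  have Nc: "N \<in> carrier_mat (Suc n) (Suc n)" using Wc M by (auto simp: N_def)
  have NH: "mat_adjoint N = N"
  proof -
    have "mat_adjoint N = mat_adjoint (M * W) * W"
      unfolding N_def using Wc M by (subst mat_adjoint_mult[of _ "Suc n" "Suc n" _ "Suc n"]) auto
    also have "\<dots> = (mat_adjoint W * M) * W"
      using Wc M H by (subst mat_adjoint_mult[of _ "Suc n" "Suc n" _ "Suc n"]) auto
    also have "\<dots> = N" unfolding N_def using Wc M 
      by (intro assoc_mult_mat[of _ "Suc n" "Suc n" _ "Suc n" _ "Suc n"]) auto
    finally show ?thesis .
  qed
  have Nij: "N $$ (i, j) = cnj (N $$ (j, i))" if "i < Suc n" "j < Suc n" for i j
    using mat_adjoint_index[of i N j] Nc NH that by simp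
  have N0: "N $$ (i, 0) = (if i = 0 then e else 0)" if i: "i < Suc n" for i
  proof -
    have "N $$ (i, 0) = row (mat_adjoint W) i \<bullet> col (M * W) 0"
      unfolding N_def using i Wc M by auto
    also have "col (M * W) 0 = M *\<^sub>v col W 0" using Wc M by auto
    also have "\<dots> = e \<cdot>\<^sub>v col W 0"
      unfolding colW using M v Mv by (auto simp: mult_mat_vec[of _ "Suc n" "Suc n"] smult_smult_assoc mult.commute)
    also have "row (mat_adjoint W) i \<bullet> \<dots> = e * (row (mat_adjoint W) i \<bullet> col W 0)"
      by (rule scalar_prod_smult_distrib[of _ "Suc n"]) (rule carrier_vecI, use Wc in simp)+
    also have "row (mat_adjoint W) i \<bullet> col W 0 = (mat_adjoint W * W) $$ (i, 0)"
      using Wc i by auto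
    finally show ?thesis using i by (simp add: WW(2) del: index_mult_mat)
  qed
  have N0': "N $$ (0, i) = (if i = 0 then e else 0)" if i: "i < Suc n" for i
  proof -
    have "N $$ (0, i) = cnj (N $$ (i, 0))"
      by (rule Nij) (use i in auto)
    moreover have "N $$ (0, 0) = cnj (N $$ (0, 0))"
      by (rule Nij) auto
    ultimately show ?thesis using N0[OF i] N0[of 0] by auto
  qed
  have e: "e = complex_of_real (Re e)"
  proof -
    have "N $$ (0, 0) = cnj (N $$ (0, 0))"
      by (rule Nij) auto
    then show ?thesis using N0[of 0] by (auto simp: complex_eq_iff)
  qed
  define N' where "N' = mat n n (\<lambda>(i, j). N $$ (Suc i, Suc j))"
  have "mat_adjoint N' = N'"
  proof (rule eq_matI)
    fix i j assume "i < dim_row N'" "j < dim_col N'"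
    then have "i < n" "j < n" by (auto simp: N'_def)
    then show "mat_adjoint N' $$ (i, j) = N' $$ (i, j)"
      using Nc NH mat_adjoint_index[of "Suc i" N "Suc j"] by (simp add: N'_def)
  qed (auto simp: N'_def)
  then obtain U' d' where "spectral n N' U' d'" using Suc.IH[of N'] by (auto simp: N'_def)
  then have U': "unitary_mat n U'" and U'c: "U' \<in> carrier_mat n n" and U'U: "mat_adjoint U' * U' = 1\<^sub>m n"
    and N'U: "N' = U' * mat_diag n (\<lambda>i. complex_of_real (d' i)) * mat_adjoint U'"
    by (auto simp: spectral_def unitary_mat_def)
  \<comment> \<open>Extending \<open>U'\<close> by a 1 in the corner gives a unitary that
    diagonalises \<open>N\<close>. Hence \<open>W * Z\<close> diagonalises \<open>M\<close>, with
    the eigenvalue \<open>e\<close> put in front of the values \<open>d'\<close>.\<close>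
  define Z where "Z = four_block_mat (1\<^sub>m 1) (0\<^sub>m 1 n) (0\<^sub>m n 1) U'"
  define d where "d = case_nat (Re e) d'"
  have Zc: "Z \<in> carrier_mat (Suc n) (Suc n)" using U'c by (auto simp: Z_def)
  have Zadj: "mat_adjoint Z = four_block_mat (1\<^sub>m 1) (0\<^sub>m 1 n) (0\<^sub>m n 1) (mat_adjoint U')"
    using U'c by (intro eq_matI) (auto simp: Z_def)
  have Zu: "unitary_mat (Suc n) Z"
  proof (rule unitary_matI[OF Zc])
    have "mat_adjoint Z * Z = four_block_mat (1\<^sub>m 1) (0\<^sub>m 1 n) (0\<^sub>m n 1) (1\<^sub>m n)"
      unfolding Zadj unfolding Z_def using U'c U'U
      by (subst mult_four_block_mat[of _ 1 1 _ n _ n _ _ 1 _ n]) auto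
    then show "mat_adjoint Z * Z = 1\<^sub>m (Suc n)" by simp
  qed
  have D: "mat_diag (Suc n) (\<lambda>i. complex_of_real (d i)) =
      four_block_mat (mat 1 1 (\<lambda>_. e)) (0\<^sub>m 1 n) (0\<^sub>m n 1) (mat_diag n (\<lambda>i. complex_of_real (d' i)))"
    by (intro eq_matI) (auto simp: mat_diag_def d_def e[symmetric] split: nat.splits)
  have "Z * mat_diag (Suc n) (\<lambda>i. complex_of_real (d i)) =
     four_block_mat (mat 1 1 (\<lambda>_. e)) (0\<^sub>m 1 n) (0\<^sub>m n 1) (U' * mat_diag n (\<lambda>i. complex_of_real (d' i)))"
    unfolding Z_def D using U'c
    by (subst mult_four_block_mat[of _ 1 1 _ n _ n _ _ 1 _ n]) (auto simp: left_mult_zero_mat[OF mat_diag_dim])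
  moreover have E: "U' * mat_diag n (\<lambda>i. complex_of_real (d' i)) \<in> carrier_mat n n"
    "U' * mat_diag n (\<lambda>i. complex_of_real (d' i)) * mat_adjoint U' \<in> carrier_mat n n"
    using U'c by (auto intro!: mult_carrier_mat[of _ n n])
  ultimately have "Z * mat_diag (Suc n) (\<lambda>i. complex_of_real (d i)) * mat_adjoint Z =
     four_block_mat (mat 1 1 (\<lambda>_. e)) (0\<^sub>m 1 n) (0\<^sub>m n 1) N'"
    unfolding Zadj N'U using U'c
    by (simp, subst mult_four_block_mat[of _ 1 1 _ n _ n _ _ 1 _ n])
      (auto simp: right_mult_zero_mat[of _ n n] left_add_zero_mat[of _ n n])
  also have "\<dots> = N"
  proof (rule eq_matI)
    fix i j assume "i < dim_row N" "j < dim_col N"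
    then have "i < Suc n" "j < Suc n" using Nc by auto
    then show "four_block_mat (mat 1 1 (\<lambda>_. e)) (0\<^sub>m 1 n) (0\<^sub>m n 1) N' $$ (i, j) = N $$ (i, j)"
      using N0 N0' by (cases i; cases j) (auto simp: N'_def)
  qed (use Nc in \<open>auto simp: N'_def\<close>)
  finally have ZN: "Z * mat_diag (Suc n) (\<lambda>i. complex_of_real (d i)) * mat_adjoint Z = N" .
  let ?D = "mat_diag (Suc n) (\<lambda>i. complex_of_real (d i))"
  note as = assoc_mult_mat[of _ "Suc n" "Suc n" _ "Suc n" _ "Suc n"]
  have "(W * Z) * ?D * mat_adjoint (W * Z) = W * (Z * ?D * mat_adjoint Z) * mat_adjoint W"
    using Wc Zc by (simp add: mat_adjoint_mult[of _ "Suc n" "Suc n" _ "Suc n"] as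
      mult_carrier_mat[of _ "Suc n" "Suc n" _ "Suc n"])
  also have "\<dots> = (W * mat_adjoint W) * M * (W * mat_adjoint W)"
    unfolding ZN N_def using Wc M by (simp add: as mult_carrier_mat[of _ "Suc n" "Suc n" _ "Suc n"])
  also have "\<dots> = M" using M by (simp add: WW)
  finally have "spectral (Suc n) M (W * Z) d"
    unfolding spectral_def using unitary_mat_mult[OF W Zu] by auto
  then show ?case by blast
qed

section \<open>Scalar inequalities for concave powers\<close>

text \<open>The right side is the tangent at 1 of a concave function. Equivalently, this is the
  weighted AM-GM inequality for \<open>t\<close> and 1.\<close>

lemma powr_tangent:
  fixes a t :: real
  assumes "0 < a" "a < 1" "t \<ge> 0"
  shows "t powr a \<le> a * t + (1 - a)"
proof (cases "t = 0")
  case False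
  with assms have t: "t > 0" by simp
  \<comment> \<open>After division by \<open>s\<close>, the points \<open>t / s\<close> and
    \<open>1 / s\<close> have weighted mean 1, so the two bounds \<open>ln y \<le> y - 1\<close> add
    up to zero.\<close>
  define s where "s = a * t + (1 - a)"
  have s: "s > 0" unfolding s_def using assms t by (simp add: add_pos_pos)
  have "a * ln (t / s) + (1 - a) * ln (1 / s) \<le> a * (t / s - 1) + (1 - a) * (1 / s - 1)"
    using assms t s by (intro add_mono mult_left_mono ln_le_minus_one) auto
  also have "\<dots> = (a * t + (1 - a)) / s - 1" using s by (simp add: field_simps)
  also have "\<dots> = 0" using s by (simp add: s_def)
  finally have "a * ln t \<le> ln s" using t s by (simp add: ln_div algebra_simps)
  then have "exp (a * ln t) \<le> s" using s by (metis exp_le_cancel_iff exp_ln)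
  then show ?thesis using t by (simp add: powr_def s_def)
qed (use assms in simp)

text \<open>Dividing the points by their mean \<open>c\<close> moves the point of tangency to 1,
  where \<open>powr_tangent\<close> applies; the linear terms then average to 1. If
  \<open>c = 0\<close>, every product \<open>w k * t k\<close> vanishes.\<close>

lemma powr_jensen:
  fixes w t :: "'a \<Rightarrow> real"
  assumes a: "0 < a" "a < 1" and w: "\<And>k. k \<in> K \<Longrightarrow> w k \<ge> 0" "sum w K = 1"
    and t: "\<And>k. k \<in> K \<Longrightarrow> t k \<ge> 0"
  shows "(\<Sum>k\<in>K. w k * t k powr a) \<le> (\<Sum>k\<in>K. w k * t k) powr a"
proof -
  have fin: "finite K" using w(2) by (metis sum.infinite zero_neq_one)
  define c where "c = (\<Sum>k\<in>K. w k * t k)"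
  have c0: "c \<ge> 0" unfolding c_def by (intro sum_nonneg) (simp add: w t)
  show ?thesis
  proof (cases "c = 0")
    case True
    then have "w k * t k = 0" if "k \<in> K" for k
      using that fin w t by (simp add: c_def sum_nonneg_eq_0_iff)
    then have "w k * t k powr a = 0" if "k \<in> K" for k using that by fastforce
    then show ?thesis using True c_def by simp
  next
    case False
    with c0 have c: "c > 0" by simp
    have "(\<Sum>k\<in>K. w k * t k powr a) = (\<Sum>k\<in>K. w k * (c powr a * (t k / c) powr a))"
      using c t by (intro sum.cong) (auto simp: powr_divide)
    also have "\<dots> \<le> (\<Sum>k\<in>K. w k * (c powr a * (a * (t k / c) + (1 - a))))"
      using c t w a by (intro sum_mono mult_left_mono powr_tangent) auto
    also have "\<dots> = c powr a * (a / c * (\<Sum>k\<in>K. w k * t k) + (1 - a) * sum w K)"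
      using sum_distrib_right[of w K "c powr a"]
      by (simp add: sum_distrib_left sum.distrib sum_subtractf algebra_simps)
    also have "\<dots> = c powr a" using c w unfolding c_def[symmetric] by simp
    finally show ?thesis unfolding c_def .
  qed
qed

text \<open>Below exponent 1 the triangle inequality reverses on nonnegative vectors. Concavity is
  applied in each coordinate, with weights adapted to the quasinorms \<open>S\<close> and
  \<open>T\<close> of the two vectors.\<close>

lemma reverse_minkowski:
  fixes u v :: "'a \<Rightarrow> real"
  assumes a: "0 < a" "a < 1" and u: "\<And>i. i \<in> I \<Longrightarrow> u i \<ge> 0" and v: "\<And>i. i \<in> I \<Longrightarrow> v i \<ge> 0"
  shows "(\<Sum>i\<in>I. u i powr a) powr (1 / a) + (\<Sum>i\<in>I. v i powr a) powr (1 / a)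
    \<le> (\<Sum>i\<in>I. (u i + v i) powr a) powr (1 / a)"
proof -
  define S where "S = (\<Sum>i\<in>I. u i powr a) powr (1 / a)"
  define T where "T = (\<Sum>i\<in>I. v i powr a) powr (1 / a)"
  have Sa: "S powr a = (\<Sum>i\<in>I. u i powr a)" and Ta: "T powr a = (\<Sum>i\<in>I. v i powr a)"
    using a by (auto simp: S_def T_def powr_powr sum_nonneg)
  have ST: "S \<ge> 0" "T \<ge> 0" by (auto simp: S_def T_def)
  have "(S + T) powr a \<le> (\<Sum>i\<in>I. (u i + v i) powr a)"
  proof (cases "S = 0 \<or> T = 0")
    case True
    have "(\<Sum>i\<in>I. u i powr a) \<le> (\<Sum>i\<in>I. (u i + v i) powr a)"
      "(\<Sum>i\<in>I. v i powr a) \<le> (\<Sum>i\<in>I. (u i + v i) powr a)"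
      using a u v by (auto intro!: sum_mono powr_mono2)
    then show ?thesis using True Sa Ta by auto
  next
    case False
    with ST have ST: "S > 0" "T > 0" by auto
    \<comment> \<open>For this weight \<open>S / t\<close> and \<open>T / (1 - t)\<close> both equal
      \<open>S + T\<close>, so the summed coordinate bounds give exactly
      \<open>(S + T) powr a\<close>.\<close>
    define t where "t = S / (S + T)"
    have t: "t > 0" "1 - t > 0" "1 - t = T / (S + T)" using ST by (auto simp: t_def field_simps)
    have pt: "t * (u i / t) powr a + (1 - t) * (v i / (1 - t)) powr a \<le> (u i + v i) powr a"
      if "i \<in> I" for i
    proof -
      \<comment> \<open>Jensen for two points, with \<open>bool\<close> as the index set.\<close>
      have "(\<Sum>b\<in>UNIV. (if b then t else 1 - t) * (if b then u i / t else v i / (1 - t)) powr a)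
          \<le> (\<Sum>b\<in>UNIV. (if b then t else 1 - t) * (if b then u i / t else v i / (1 - t))) powr a"
        using t(1,2) u[OF that] v[OF that] by (intro powr_jensen[OF a]) (auto simp: UNIV_bool)
      moreover have "t * (u i / t) + (1 - t) * (v i / (1 - t)) = u i + v i"
        using t(1,2) by simp
      ultimately show ?thesis by (simp add: UNIV_bool add.commute)
    qed
    have "t * (1 / t) powr a * S powr a + (1 - t) * (1 / (1 - t)) powr a * T powr a
        = (\<Sum>i\<in>I. t * (u i / t) powr a + (1 - t) * (v i / (1 - t)) powr a)"
      unfolding Sa Ta using t(1,2) u v
      by (simp add: sum.distrib sum_distrib_left powr_divide powr_mult)
    also have "\<dots> \<le> (\<Sum>i\<in>I. (u i + v i) powr a)" by (intro sum_mono pt)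
    also have "t * (1 / t) powr a * S powr a + (1 - t) * (1 / (1 - t)) powr a * T powr a
       = t * (S / t) powr a + (1 - t) * (T / (1 - t)) powr a"
      using t ST by (simp add: powr_divide)
    also have "S / t = S + T" using ST by (simp add: t_def)
    also have "T / (1 - t) = S + T" using ST by (simp add: t)
    also have "t * (S + T) powr a + (1 - t) * (S + T) powr a = (S + T) powr a"
      by (simp add: algebra_simps)
    finally show ?thesis .
  qed
  then have "((S + T) powr a) powr (1 / a) \<le> (\<Sum>i\<in>I. (u i + v i) powr a) powr (1 / a)"
    using a by (intro powr_mono2) auto
  then show ?thesis using a ST by (simp add: powr_powr S_def T_def)
qed

lemma reverse_minkowski_list:
  fixes u :: "'b \<Rightarrow> 'a \<Rightarrow> real"
  assumes a: "0 < a" "a < 1" and "\<And>l i. i \<in> I \<Longrightarrow> u l i \<ge> 0"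
  shows "(\<Sum>l\<leftarrow>ls. (\<Sum>i\<in>I. u l i powr a) powr (1 / a)) \<le> (\<Sum>i\<in>I. (\<Sum>l\<leftarrow>ls. u l i) powr a) powr (1 / a)"
proof (induction ls)
  case (Cons l ls)
  have "(\<Sum>l\<leftarrow>ls. u l i) \<ge> 0" if "i \<in> I" for i
    using assms(3)[OF that] by (intro sum_list_nonneg) auto
  then show ?case
    using Cons reverse_minkowski[OF a, of I "u l" "\<lambda>i. \<Sum>l\<leftarrow>ls. u l i"] assms(3) by simp
qed simp

section \<open>Traces of functions of a Hermitian matrix\<close>

lemma conj_diag_entry:
  fixes U :: "complex mat"
  assumes "U \<in> carrier_mat m n" "i < m" "j < m"
  shows "(U * mat_diag n g * mat_adjoint U) $$ (i, j) = (\<Sum>k<n. U $$ (i, k) * g k * cnj (U $$ (j, k)))"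
proof -
  have "U * mat_diag n g = mat m n (\<lambda>(i, j). U $$ (i, j) * g j)"
    using assms by (intro mat_diag_mult_right) auto
  then show ?thesis
    using assms by (subst index_mult_mat_sum[of _ m n _ m]) (auto intro!: sum.cong)
qed

lemma mat_trace_conj_diag:
  assumes "unitary_mat n U"
  shows "mat_trace (U * mat_diag n g * mat_adjoint U) = (\<Sum>k<n. g k)"
proof -
  have U: "U \<in> carrier_mat n n" using assms by (auto simp: unitary_mat_def)
  have "mat_trace (U * mat_diag n g * mat_adjoint U)
      = (\<Sum>i<n. \<Sum>k<n. g k * complex_of_real ((cmod (U $$ (i, k)))\<^sup>2))"
    unfolding mat_trace_def using U
    by (auto intro!: sum.cong simp: conj_diag_entry[OF U] complex_norm_square simp del: of_real_power index_mult_mat(1))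
  also have "\<dots> = (\<Sum>k<n. g k * complex_of_real (\<Sum>i<n. (cmod (U $$ (i, k)))\<^sup>2))"
    by (subst sum.swap) (simp add: sum_distrib_left)
  also have "\<dots> = (\<Sum>k<n. g k)" using unitary_mat_col[OF assms] by simp
  finally show ?thesis .
qed

lemma spectral_carrier:
  assumes "spectral n M U d"
  shows "U \<in> carrier_mat n n" "M \<in> carrier_mat n n" "unitary_mat n U"
  using assms by (auto simp: spectral_def unitary_mat_def intro!: mult_carrier_mat[of _ n n])

lemma spectral_eigen:
  assumes "spectral n M U d"
  shows "M * U = U * mat_diag n (\<lambda>i. complex_of_real (d i))"
proof -
  note [simp] = spectral_carrier[OF assms]
  have "M * U = U * mat_diag n (\<lambda>i. complex_of_real (d i)) * (mat_adjoint U * U)"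
    using assms by (simp add: spectral_def assoc_mult_mat[of _ n n _ n _ n] mult_carrier_mat[of _ n n _ n])
  then show ?thesis
    using spectral_carrier(3)[OF assms] right_mult_one_mat[of "U * _" n n]
    by (simp add: unitary_mat_def mult_carrier_mat[of _ n n _ n])
qed

lemma spectral_eigen_adjoint:
  assumes "spectral n M U d"
  shows "mat_adjoint U * M = mat_diag n (\<lambda>i. complex_of_real (d i)) * mat_adjoint U"
proof -
  note [simp] = spectral_carrier[OF assms]
  let ?D = "mat_diag n (\<lambda>i. complex_of_real (d i))"
  have [simp]: "?D * mat_adjoint U \<in> carrier_mat n n" "U * ?D \<in> carrier_mat n n"
    by (auto intro!: mult_carrier_mat[of _ n n])
  have "mat_adjoint U * M = mat_adjoint U * (U * (?D * mat_adjoint U))"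
    using assms by (simp add: spectral_def assoc_mult_mat[of _ n n _ n _ n])
  also have "\<dots> = (mat_adjoint U * U) * (?D * mat_adjoint U)"
    by (simp add: assoc_mult_mat[of _ n n _ n _ n])
  finally show ?thesis
    using spectral_carrier(3)[OF assms] by (simp add: unitary_mat_def left_mult_one_mat[of _ n n])
qed

text \<open>Comparing entries shows that \<open>Y $$ (i, j) \<noteq> 0\<close> forces
  \<open>d i = e j\<close>, so \<open>h\<close> can be moved from rows to columns. The square
  unitary case yields uniqueness of spectral sums, the rectangular case compares the two Gram
  matrices of \<open>X\<close>.\<close>

lemma intertwine_diag:
  fixes Y :: "complex mat" and d e :: "nat \<Rightarrow> real"
  assumes Y: "Y \<in> carrier_mat n m"
    and eq: "mat_diag n (\<lambda>i. complex_of_real (d i)) * Y = Y * mat_diag m (\<lambda>i. complex_of_real (e i))"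
  shows "(\<Sum>i<n. h (d i) * (\<Sum>j<m. (cmod (Y $$ (i, j)))\<^sup>2)) = (\<Sum>j<m. h (e j) * (\<Sum>i<n. (cmod (Y $$ (i, j)))\<^sup>2))"
proof -
  have "d i = e j" if "i < n" "j < m" "Y $$ (i, j) \<noteq> 0" for i j
    using arg_cong[OF eq, of "\<lambda>M. M $$ (i, j)"] that
    by (simp add: mat_diag_mult_left[OF Y] mat_diag_mult_right[OF Y])
  then have "h (d i) * (cmod (Y $$ (i, j)))\<^sup>2 = h (e j) * (cmod (Y $$ (i, j)))\<^sup>2" if "i < n" "j < m" for i j
    using that by (cases "Y $$ (i, j) = 0") auto
  then show ?thesis
    unfolding sum_distrib_left by (subst sum.swap) (intro sum.cong, auto)
qed

text \<open>The change of basis \<open>W\<close> between the two eigenbases intertwines the diagonal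
  forms, and its rows and columns have norm one, so the weighted sums of
  \<open>intertwine_diag\<close> become plain sums.\<close>

lemma spectral_sum_unique:
  fixes f :: "real \<Rightarrow> real"
  assumes "spectral n M U d" "spectral n M V e"
  shows "(\<Sum>i<n. f (d i)) = (\<Sum>i<n. f (e i))"
proof -
  note [simp] = spectral_carrier[OF assms(1)] spectral_carrier[OF assms(2)]
  let ?D = "mat_diag n (\<lambda>i. complex_of_real (d i))" and ?E = "mat_diag n (\<lambda>i. complex_of_real (e i))"
  define W where "W = mat_adjoint U * V"
  have W: "W \<in> carrier_mat n n" "unitary_mat n W"
    unfolding W_def by (auto intro!: mult_carrier_mat[of _ n n] unitary_mat_mult unitary_mat_adjoint)
  have "?D * W = (mat_adjoint U * M) * V"
    unfolding W_def spectral_eigen_adjoint[OF assms(1)] by (simp add: assoc_mult_mat[of _ n n _ n _ n])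
  also have "\<dots> = mat_adjoint U * (V * ?E)"
    unfolding spectral_eigen[OF assms(2), symmetric] by (simp add: assoc_mult_mat[of _ n n _ n _ n])
  also have "\<dots> = W * ?E"
    unfolding W_def by (simp add: assoc_mult_mat[of _ n n _ n _ n])
  finally show ?thesis
    using intertwine_diag[OF W(1), of d e f] unitary_mat_row[OF W(2)] unitary_mat_col[OF W(2)] by simp
qed

text \<open>The choice operator in \<open>mat_fun\<close> may rest on another eigenbasis than the
  given one, so the chosen one is made explicit here; its dimension is forced by that of
  \<open>M\<close>. Traces are carried back to \<open>d\<close> by
  \<open>spectral_sum_unique\<close>.\<close>

lemma spectral_mat_fun:
  assumes "spectral n M U d"
  obtains V e where "spectral n M V e"
    "mat_fun f M = V * mat_diag n (\<lambda>i. complex_of_real (f (e i))) * mat_adjoint V"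
proof -
  have "is_mat_fun f M (mat_fun f M)"
    unfolding mat_fun_def by (rule someI_ex) (use assms in \<open>unfold is_mat_fun_def spectral_def unitary_mat_def, blast\<close>)
  then obtain k V e where V: "V \<in> carrier_mat k k" "V * mat_adjoint V = 1\<^sub>m k" "mat_adjoint V * V = 1\<^sub>m k"
    "M = V * mat_diag k (\<lambda>i. complex_of_real (e i)) * mat_adjoint V"
    "mat_fun f M = V * mat_diag k (\<lambda>i. complex_of_real (f (e i))) * mat_adjoint V"
    unfolding is_mat_fun_def by blast
  then have "spectral k M V e" by (simp add: spectral_def unitary_mat_def)
  moreover from this have "k = n"
    using spectral_carrier(2)[OF assms] spectral_carrier(2) by fastforce
  ultimately show ?thesis using V that by blast
qed

lemma mat_trace_mat_fun:
  assumes "spectral n M U d"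
  shows "mat_trace (mat_fun f M) = complex_of_real (\<Sum>i<n. f (d i))"
proof -
  obtain V e where V: "spectral n M V e"
    "mat_fun f M = V * mat_diag n (\<lambda>i. complex_of_real (f (e i))) * mat_adjoint V"
    using spectral_mat_fun[OF assms] .
  then show ?thesis
    using spectral_sum_unique[OF assms V(1), of f] spectral_carrier(3)[OF V(1)] by (simp add: mat_trace_conj_diag)
qed

lemma mat_trace_mult_mat_fun:
  assumes "spectral n M U d"
  shows "mat_trace (M * mat_fun f M) = complex_of_real (\<Sum>i<n. d i * f (d i))"
proof -
  obtain V e where V: "spectral n M V e"
    "mat_fun f M = V * mat_diag n (\<lambda>i. complex_of_real (f (e i))) * mat_adjoint V"
    using spectral_mat_fun[OF assms] .
  note [simp] = spectral_carrier[OF V(1)]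
  let ?E = "mat_diag n (\<lambda>i. complex_of_real (e i))" and ?F = "mat_diag n (\<lambda>i. complex_of_real (f (e i)))"
  have [simp]: "V * ?E \<in> carrier_mat n n" "V * ?F \<in> carrier_mat n n"
    by (auto intro!: mult_carrier_mat[of _ n n])
  have "M * mat_fun f M = (M * V) * ?F * mat_adjoint V"
    unfolding V(2) by (simp add: assoc_mult_mat[of _ n n _ n _ n] mult_carrier_mat[of _ n n _ n])
  also have "\<dots> = V * (?E * ?F) * mat_adjoint V"
    unfolding spectral_eigen[OF V(1)] by (simp add: assoc_mult_mat[of _ n n _ n _ n] del: mat_diag_diag)
  finally have "M * mat_fun f M = V * mat_diag n (\<lambda>i. complex_of_real (e i * f (e i))) * mat_adjoint V"
    by simp
  then show ?thesis
    using spectral_sum_unique[OF assms V(1), of "\<lambda>t. t * f t"] by (simp add: mat_trace_conj_diag)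
qed

section \<open>Gram matrices\<close>

lemma gram_mult_left:
  fixes A X :: "complex mat"
  assumes [simp]: "A \<in> carrier_mat k n" "X \<in> carrier_mat n m"
  shows "(A * X) * mat_adjoint (A * X) = A * (X * mat_adjoint X) * mat_adjoint A"
  by (simp add: mat_adjoint_mult[of _ k n _ m] assoc_mult_mat[of _ k n _ m _ k] assoc_mult_mat[of _ n m _ n _ k]
      assoc_mult_mat[of _ k n _ n _ k] mult_carrier_mat[of _ m n _ k] mult_carrier_mat[of _ n m _ n])

lemma gram_mult_unitary:
  fixes V X :: "complex mat"
  assumes X [simp]: "X \<in> carrier_mat n m" and V: "unitary_mat m V"
  shows "(X * V) * mat_adjoint (X * V) = X * mat_adjoint X"
proof -
  have [simp]: "V \<in> carrier_mat m m" using V by (simp add: unitary_mat_def)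
  show ?thesis
    using V
    by (simp add: gram_mult_left[of _ n m _ m] unitary_mat_def right_mult_one_mat[of _ n m])
qed

lemma row_norm_mult_unitary:
  fixes V X :: "complex mat"
  assumes X: "X \<in> carrier_mat n m" and V: "unitary_mat m V" and i: "i < n"
  shows "(\<Sum>j<m. (cmod ((X * V) $$ (i, j)))\<^sup>2) = (\<Sum>j<m. (cmod (X $$ (i, j)))\<^sup>2)"
proof -
  have "X * V \<in> carrier_mat n m" using V X by (auto simp: unitary_mat_def intro!: mult_carrier_mat[of _ n m])
  from mult_adjoint_diag[OF this i] mult_adjoint_diag[OF X i] show ?thesis
    unfolding gram_mult_unitary[OF X V] by (metis of_real_eq_iff)
qed

text \<open>Conjugating \<open>X * mat_adjoint X\<close> by \<open>U\<close> gives both the diagonal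
  matrix of \<open>d\<close> and the Gram matrix of \<open>mat_adjoint U * X\<close>; their
  diagonals agree. In particular the eigenvalues are nonnegative.\<close>

lemma gram_spectral_row:
  assumes X: "X \<in> carrier_mat n m" and U: "spectral n (X * mat_adjoint X) U d" and i: "i < n"
  shows "d i = (\<Sum>l<m. (cmod ((mat_adjoint U * X) $$ (i, l)))\<^sup>2)"
proof -
  note [simp] = spectral_carrier(1)[OF U]
  have c: "mat_adjoint U * X \<in> carrier_mat n m" using X by (auto intro!: mult_carrier_mat[of _ n n])
  have "(mat_adjoint U * X) * mat_adjoint (mat_adjoint U * X) = mat_adjoint U * (X * mat_adjoint X) * U"
    using X by (simp add: gram_mult_left[of _ n n _ m])
  also have "\<dots> = mat_diag n (\<lambda>i. complex_of_real (d i)) * (mat_adjoint U * U)"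
    unfolding spectral_eigen_adjoint[OF U] by (simp add: assoc_mult_mat[of _ n n _ n _ n])
  also have "\<dots> = mat_diag n (\<lambda>i. complex_of_real (d i))"
    using spectral_carrier(3)[OF U] by (simp add: unitary_mat_def right_mult_one_mat[of _ n n])
  finally have "complex_of_real (d i) = complex_of_real (\<Sum>l<m. (cmod ((mat_adjoint U * X) $$ (i, l)))\<^sup>2)"
    using mult_adjoint_diag[OF c i] i by (simp add: mat_diag_def)
  then show ?thesis by (simp only: of_real_eq_iff)
qed

lemma gram_spectral_exists:
  fixes X :: "complex mat"
  assumes X: "X \<in> carrier_mat n m"
  obtains U d where "spectral n (X * mat_adjoint X) U d"
proof -
  have "mat_adjoint (X * mat_adjoint X) = X * mat_adjoint X"
    using X by (subst mat_adjoint_mult[of _ n m _ n]) auto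
  moreover have "X * mat_adjoint X \<in> carrier_mat n n" using X by (auto intro!: mult_carrier_mat[of _ n m])
  ultimately show ?thesis using hermitian_spectral that by blast
qed

lemma gram_spectral_nonneg:
  assumes "X \<in> carrier_mat n m" "spectral n (X * mat_adjoint X) U d" "i < n"
  shows "d i \<ge> 0"
  using gram_spectral_row[OF assms] by (simp add: sum_nonneg)

lemma gram_spectral_sum:
  assumes X: "X \<in> carrier_mat n m" and U: "spectral n (X * mat_adjoint X) U d"
  shows "(\<Sum>i<n. d i) = (\<Sum>i<n. \<Sum>l<m. (cmod (X $$ (i, l)))\<^sup>2)"
proof -
  have "complex_of_real (\<Sum>i<n. d i) = mat_trace (X * mat_adjoint X)"
    using U mat_trace_conj_diag[OF spectral_carrier(3)[OF U]] by (simp add: spectral_def)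
  also have "\<dots> = complex_of_real (\<Sum>i<n. \<Sum>l<m. (cmod (X $$ (i, l)))\<^sup>2)"
    unfolding mat_trace_def using X
    by (simp add: mult_adjoint_diag[OF X] del: of_real_power index_mult_mat(1))
  finally show ?thesis by (simp only: of_real_eq_iff)
qed

text \<open>
  \<open>Y = U\<^sup>\<dagger> X V\<close> intertwines the two diagonal forms, so \<open>Y\<^sub>i\<^sub>j \<noteq> 0\<close> forces \<open>d\<^sub>i = e\<^sub>j\<close>, while its rows and
  columns have squared norms \<open>d\<^sub>i\<close> and \<open>e\<^sub>j\<close>; this compares the sums of \<open>f(t) = f(t)/t \<cdot> t\<close>.
\<close>

lemma gram_swap_sum:
  fixes f :: "real \<Rightarrow> real"
  assumes X: "X \<in> carrier_mat n m" and U: "spectral n (X * mat_adjoint X) U d"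
    and V: "spectral m (mat_adjoint X * X) V e" and f: "f 0 = 0"
  shows "(\<Sum>i<n. f (d i)) = (\<Sum>j<m. f (e j))"
proof -
  note [simp] = X spectral_carrier(1)[OF U] spectral_carrier(1)[OF V]
  let ?D = "mat_diag n (\<lambda>i. complex_of_real (d i))" and ?E = "mat_diag m (\<lambda>i. complex_of_real (e i))"
  define Y where "Y = mat_adjoint U * X * V"
  have c [simp]: "mat_adjoint U * X \<in> carrier_mat n m" "mat_adjoint V * mat_adjoint X \<in> carrier_mat m n"
    "X * V \<in> carrier_mat n m" "mat_adjoint X * X \<in> carrier_mat m m" "X * mat_adjoint X \<in> carrier_mat n n"
    by (simp_all add: mult_carrier_mat[of _ n n _ m] mult_carrier_mat[of _ m m _ n]
        mult_carrier_mat[of _ n m _ m] mult_carrier_mat[of _ m n _ m] mult_carrier_mat[of _ n m _ n])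
  have Y: "Y \<in> carrier_mat n m" unfolding Y_def by (rule mult_carrier_mat[OF c(1)]) simp
  have "?D * Y = (?D * mat_adjoint U) * (X * V)"
    unfolding Y_def by (simp add: assoc_mult_mat[of _ n n _ n _ m] assoc_mult_mat[of _ n n _ m _ m])
  also have "\<dots> = mat_adjoint U * X * (mat_adjoint X * X * V)"
    unfolding spectral_eigen_adjoint[OF U, symmetric]
    by (simp add: assoc_mult_mat[of _ n n _ n _ m] assoc_mult_mat[of _ n m _ n _ m] assoc_mult_mat[of _ n n _ m _ m]
      assoc_mult_mat[of _ m n _ m _ m] mult_carrier_mat[of _ m n _ m])
  also have "\<dots> = Y * ?E"
    unfolding spectral_eigen[OF V] Y_def by (simp add: assoc_mult_mat[of _ n m _ m _ m])
  finally have eq: "?D * Y = Y * ?E" .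
  have row: "(\<Sum>j<m. (cmod (Y $$ (i, j)))\<^sup>2) = d i" if "i < n" for i
    unfolding Y_def row_norm_mult_unitary[OF c(1) spectral_carrier(3)[OF V] that]
    using gram_spectral_row[OF X U that] by simp
  have "mat_adjoint Y = mat_adjoint V * mat_adjoint X * U"
    unfolding Y_def by (simp add: mat_adjoint_mult[of _ n m _ m] mat_adjoint_mult[of _ n n _ m]
      assoc_mult_mat[of _ m m _ n _ n])
  then have "(\<Sum>i<n. (cmod (mat_adjoint Y $$ (j, i)))\<^sup>2) = e j" if "j < m" for j
    using row_norm_mult_unitary[OF c(2) spectral_carrier(3)[OF U] that]
      gram_spectral_row[of "mat_adjoint X" m n V e j] V that by simp
  then have col: "(\<Sum>i<n. (cmod (Y $$ (i, j)))\<^sup>2) = e j" if "j < m" for j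
    using that Y by simp
  have "(\<Sum>i<n. f (d i) / d i * d i) = (\<Sum>j<m. f (e j) / e j * e j)"
    using intertwine_diag[OF Y eq, of "\<lambda>t. f t / t"] by (simp add: row col)
  \<comment> \<open>At \<open>t = 0\<close> the left side is 0 because division by zero gives 0, and
    \<open>f 0 = 0\<close> matches it. Thus the kernels of the two Gram matrices, whose dimensions
    differ if \<open>n \<noteq> m\<close>, contribute nothing.\<close>
  moreover have "f t / t * t = f t" for t using f by (cases "t = 0") auto
  ultimately show ?thesis by simp
qed

text \<open>The squared row norms on the right are the diagonal of \<open>X * mat_adjoint X\<close>
  in the basis \<open>V\<close>. Each is an average of the eigenvalues, so Jensen applies row by
  row.\<close>

lemma peierls:
  fixes X :: "complex mat"
  assumes a: "0 < a" "a < 1" and X: "X \<in> carrier_mat n m"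
    and U: "spectral n (X * mat_adjoint X) U d" and V: "unitary_mat n V"
  shows "(\<Sum>j<n. d j powr a) \<le> (\<Sum>i<n. (\<Sum>l<m. (cmod ((mat_adjoint V * X) $$ (i, l)))\<^sup>2) powr a)"
proof -
  note [simp] = X spectral_carrier(1)[OF U]
  have Vc [simp]: "V \<in> carrier_mat n n" using V by (simp add: unitary_mat_def)
  let ?D = "mat_diag n (\<lambda>i. complex_of_real (d i))"
  define W where "W = mat_adjoint V * U"
  have Wu: "unitary_mat n W"
    unfolding W_def using V spectral_carrier(3)[OF U] by (intro unitary_mat_mult unitary_mat_adjoint)
  then have W [simp]: "W \<in> carrier_mat n n" by (simp add: unitary_mat_def)
  have c: "mat_adjoint V * X \<in> carrier_mat n m" by (auto intro!: mult_carrier_mat[of _ n n])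
  have "(mat_adjoint V * X) * mat_adjoint (mat_adjoint V * X) = mat_adjoint V * (U * ?D * mat_adjoint U) * V"
    using U by (simp add: gram_mult_left[of _ n n _ m] spectral_def)
  also have "\<dots> = W * ?D * mat_adjoint W"
    unfolding W_def by (simp add: mat_adjoint_mult[of _ n n _ n] assoc_mult_mat[of _ n n _ n _ n] mult_carrier_mat[of _ n n _ n])
  finally have eq: "(mat_adjoint V * X) * mat_adjoint (mat_adjoint V * X) = W * ?D * mat_adjoint W" .
  have u: "(\<Sum>l<m. (cmod ((mat_adjoint V * X) $$ (i, l)))\<^sup>2) = (\<Sum>j<n. (cmod (W $$ (i, j)))\<^sup>2 * d j)"
    if i: "i < n" for i
  proof -
    have "complex_of_real (\<Sum>l<m. (cmod ((mat_adjoint V * X) $$ (i, l)))\<^sup>2)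
        = (\<Sum>j<n. W $$ (i, j) * complex_of_real (d j) * cnj (W $$ (i, j)))"
      using mult_adjoint_diag[OF c i] conj_diag_entry[OF W i i] unfolding eq by simp
    also have "\<dots> = complex_of_real (\<Sum>j<n. (cmod (W $$ (i, j)))\<^sup>2 * d j)"
      unfolding of_real_sum of_real_mult complex_norm_square by (intro sum.cong) auto
    finally show ?thesis by (simp only: of_real_eq_iff)
  qed
  \<comment> \<open>the matrix \<open>|W\<^sub>i\<^sub>j|\<^sup>2\<close> is doubly stochastic\<close>
  have "(\<Sum>j<n. d j powr a) = (\<Sum>j<n. (\<Sum>i<n. (cmod (W $$ (i, j)))\<^sup>2) * d j powr a)"
    using unitary_mat_col[OF Wu] by simp
  also have "\<dots> = (\<Sum>i<n. \<Sum>j<n. (cmod (W $$ (i, j)))\<^sup>2 * d j powr a)"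
    unfolding sum_distrib_right by (rule sum.swap)
  also have "\<dots> \<le> (\<Sum>i<n. (\<Sum>j<n. (cmod (W $$ (i, j)))\<^sup>2 * d j) powr a)"
    using unitary_mat_row[OF Wu] gram_spectral_nonneg[OF X U]
    by (intro sum_mono powr_jensen a) auto
  also have "\<dots> = (\<Sum>i<n. (\<Sum>l<m. (cmod ((mat_adjoint V * X) $$ (i, l)))\<^sup>2) powr a)"
    using u by simp
  finally show ?thesis .
qed

text \<open>The functional N of the overview. In terms of singular values it is the square of the
  Schatten quasinorm of \<open>X\<close> of index \<open>2 * a\<close>. Writing it through
  \<open>mat_fun\<close> keeps it close to \<open>renyi_ee\<close>.\<close>

definition gram_norm :: "real \<Rightarrow> complex mat \<Rightarrow> real" where
  "gram_norm a X = Re (mat_trace (mat_fun (\<lambda>t. t powr a) (X * mat_adjoint X))) powr (1 / a)"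

lemma gram_norm_spectral:
  assumes "spectral n (X * mat_adjoint X) U d"
  shows "gram_norm a X = (\<Sum>i<n. d i powr a) powr (1 / a)"
  using mat_trace_mat_fun[OF assms] by (simp add: gram_norm_def)

text \<open>The two Gram matrices have the same nonzero spectrum, and \<open>0 powr a = 0\<close>
  hides the different kernels. This exchanges the roles of the two parties.\<close>

lemma gram_norm_adjoint:
  fixes X :: "complex mat"
  shows "gram_norm a (mat_adjoint X) = gram_norm a X"
proof -
  have X: "X \<in> carrier_mat (dim_row X) (dim_col X)" by simp
  obtain U d where U: "spectral (dim_row X) (X * mat_adjoint X) U d" by (rule gram_spectral_exists[OF X])
  obtain V e where V: "spectral (dim_col X) (mat_adjoint X * mat_adjoint (mat_adjoint X)) V e"
    by (rule gram_spectral_exists[OF mat_adjoint_carrier[OF X]])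
  show ?thesis
    using gram_norm_spectral[OF U] gram_norm_spectral[OF V]
      gram_swap_sum[OF X U V[unfolded mat_adjoint_adjoint], of "\<lambda>t. t powr a"] by simp
qed

lemma spectral_scale:
  assumes "spectral n M U d"
  shows "spectral n (complex_of_real c \<cdot>\<^sub>m M) U (\<lambda>i. c * d i)"
proof -
  note [simp] = spectral_carrier[OF assms]
  have "mat_diag n (\<lambda>i. complex_of_real (c * d i)) = complex_of_real c \<cdot>\<^sub>m mat_diag n (\<lambda>i. complex_of_real (d i))"
    by (intro eq_matI) (auto simp: mat_diag_def)
  then have "U * mat_diag n (\<lambda>i. complex_of_real (c * d i)) * mat_adjoint U
      = complex_of_real c \<cdot>\<^sub>m (U * mat_diag n (\<lambda>i. complex_of_real (d i)) * mat_adjoint U)"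
    by (simp add: mult_smult_distrib[of _ n n _ n] mult_smult_assoc_mat[of _ n n _ n] mult_carrier_mat[of _ n n _ n])
  then show ?thesis using assms by (simp add: spectral_def)
qed

text \<open>Degree two in \<open>X\<close> means degree one in the density matrix; this is what lets
  outcome probabilities be absorbed into unnormalised states.\<close>

lemma gram_norm_scale:
  fixes X :: "complex mat"
  assumes a: "0 < a"
  shows "gram_norm a (complex_of_real c \<cdot>\<^sub>m X) = c\<^sup>2 * gram_norm a X"
proof -
  let ?n = "dim_row X"
  have X: "X \<in> carrier_mat ?n (dim_col X)" by simp
  obtain U d where U: "spectral ?n (X * mat_adjoint X) U d" by (rule gram_spectral_exists[OF X])
  have d: "d i \<ge> 0" if "i < ?n" for i using gram_spectral_nonneg[OF X U that] .
  have "mat_adjoint (complex_of_real c \<cdot>\<^sub>m X) = complex_of_real c \<cdot>\<^sub>m mat_adjoint X"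
    by (intro eq_matI) auto
  then have "(complex_of_real c \<cdot>\<^sub>m X) * mat_adjoint (complex_of_real c \<cdot>\<^sub>m X) = complex_of_real (c\<^sup>2) \<cdot>\<^sub>m (X * mat_adjoint X)"
    by (intro eq_matI) (auto simp: power2_eq_square)
  then have "spectral ?n ((complex_of_real c \<cdot>\<^sub>m X) * mat_adjoint (complex_of_real c \<cdot>\<^sub>m X)) U (\<lambda>i. c\<^sup>2 * d i)"
    using spectral_scale[OF U, of "c\<^sup>2"] by simp
  then have "gram_norm a (complex_of_real c \<cdot>\<^sub>m X) = (\<Sum>i<?n. (c\<^sup>2 * d i) powr a) powr (1 / a)"
    by (rule gram_norm_spectral)
  also have "(\<Sum>i<?n. (c\<^sup>2 * d i) powr a) = (c\<^sup>2) powr a * (\<Sum>i<?n. d i powr a)"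
    using d by (simp add: sum_distrib_left powr_mult)
  also have "\<dots> powr (1 / a) = c\<^sup>2 * gram_norm a X"
    using a by (simp add: gram_norm_spectral[OF U] powr_mult sum_nonneg powr_powr)
  finally show ?thesis .
qed

section \<open>Monotonicity under local measurements\<close>

lemma foldr_gram_carrier:
  fixes Ls :: "complex mat list"
  assumes "\<forall>L\<in>set Ls. dim_row L = m"
  shows "foldr (\<lambda>L S. L * mat_adjoint L + S) Ls (0\<^sub>m m m) \<in> carrier_mat m m"
  using assms by (induction Ls) auto

lemma sum_gram_diag:
  fixes Z :: "complex mat"
  assumes Z [simp]: "Z \<in> carrier_mat n m" and i: "i < n" and "\<forall>L\<in>set Ls. dim_row L = m"
  shows "(\<Sum>L\<leftarrow>Ls. ((Z * L) * mat_adjoint (Z * L)) $$ (i, i))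
    = (Z * foldr (\<lambda>L S. L * mat_adjoint L + S) Ls (0\<^sub>m m m) * mat_adjoint Z) $$ (i, i)"
  using assms(3)
proof (induction Ls)
  case Nil
  then show ?case using i by (simp add: right_mult_zero_mat[of _ n m] left_mult_zero_mat[of _ m n] del: index_mult_mat(1))
next
  case (Cons L Ls)
  let ?S = "foldr (\<lambda>L S. L * mat_adjoint L + S) Ls (0\<^sub>m m m)"
  have L: "L \<in> carrier_mat m (dim_col L)" and G [simp]: "L * mat_adjoint L \<in> carrier_mat m m" using Cons.prems by auto
  have S [simp]: "?S \<in> carrier_mat m m" using foldr_gram_carrier Cons.prems by auto
  have "Z * (L * mat_adjoint L + ?S) * mat_adjoint Z
      = Z * (L * mat_adjoint L) * mat_adjoint Z + Z * ?S * mat_adjoint Z"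
    by (simp add: mult_add_distrib_mat[of _ n m _ m] add_mult_distrib_mat[of _ n m _ _ n] mult_carrier_mat[of _ n m _ m])
  also have "Z * (L * mat_adjoint L) * mat_adjoint Z = (Z * L) * mat_adjoint (Z * L)"
    using gram_mult_left[OF Z L] by simp
  finally show ?case using Cons i carrier_matD[OF Z] by (simp del: index_mult_mat(1))
qed

text \<open>The eigenbasis \<open>V\<close> of the total Gram matrix is fixed once for all
  \<open>L\<close>. Only in a common basis can the vectors \<open>u L\<close> be added coordinate by
  coordinate.\<close>

lemma gram_norm_superadditive:
  fixes X :: "complex mat"
  assumes a: "0 < a" "a < 1" and X: "X \<in> carrier_mat n m"
    and Ls: "\<forall>L\<in>set Ls. dim_row L = m"
    and one: "foldr (\<lambda>L S. L * mat_adjoint L + S) Ls (0\<^sub>m m m) = 1\<^sub>m m"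
  shows "(\<Sum>L\<leftarrow>Ls. gram_norm a (X * L)) \<le> gram_norm a X"
proof -
  obtain V c where V: "spectral n (X * mat_adjoint X) V c" by (rule gram_spectral_exists[OF X])
  note [simp] = X spectral_carrier(1)[OF V]
  define Z where "Z = mat_adjoint V * X"
  have Z [simp]: "Z \<in> carrier_mat n m" by (simp add: Z_def mult_carrier_mat[of _ n n])
  \<comment> \<open>\<open>u L\<close> is the diagonal of the Gram matrix of \<open>X * L\<close> in
    the basis \<open>V\<close>.\<close>
  define u where "u L i = (\<Sum>l<dim_col L. (cmod ((Z * L) $$ (i, l)))\<^sup>2)" for L i
  have u0: "u L i \<ge> 0" for L i by (simp add: u_def sum_nonneg)
  have "gram_norm a (X * L) \<le> (\<Sum>i<n. u L i powr a) powr (1 / a)" if "L \<in> set Ls" for L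
  proof -
    have L: "L \<in> carrier_mat m (dim_col L)" using Ls that by (intro carrier_matI) auto
    have XL: "X * L \<in> carrier_mat n (dim_col L)" using mult_carrier_mat[OF X L] .
    have ZL: "Z * L = mat_adjoint V * (X * L)"
      unfolding Z_def by (rule assoc_mult_mat[OF mat_adjoint_carrier[OF spectral_carrier(1)[OF V]] X L])
    obtain U d where U: "spectral n ((X * L) * mat_adjoint (X * L)) U d" by (rule gram_spectral_exists[OF XL])
    have "(\<Sum>i<n. d i powr a) \<le> (\<Sum>i<n. u L i powr a)"
      unfolding u_def ZL by (rule peierls[OF a XL U spectral_carrier(3)[OF V]])
    then show ?thesis
      unfolding gram_norm_spectral[OF U] using a by (intro powr_mono2) (auto simp: sum_nonneg)
  qed
  then have "(\<Sum>L\<leftarrow>Ls. gram_norm a (X * L)) \<le> (\<Sum>L\<leftarrow>Ls. (\<Sum>i<n. u L i powr a) powr (1 / a))"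
    by (intro sum_list_mono) auto
  also have "\<dots> \<le> (\<Sum>i<n. (\<Sum>L\<leftarrow>Ls. u L i) powr a) powr (1 / a)"
    using u0 by (intro reverse_minkowski_list a) auto
  \<comment> \<open>By the completeness relation \<open>one\<close>, the diagonals add up to that of
    \<open>X * mat_adjoint X\<close>, which in its own eigenbasis is the spectrum
    \<open>c\<close>.\<close>
  also have "(\<Sum>i<n. (\<Sum>L\<leftarrow>Ls. u L i) powr a) = (\<Sum>i<n. c i powr a)"
  proof (intro sum.cong refl)
    fix i assume "i \<in> {..<n}"
    then have i: "i < n" by simp
    have "complex_of_real (\<Sum>L\<leftarrow>Ls. u L i) = (\<Sum>L\<leftarrow>Ls. complex_of_real (u L i))"
      by (induction Ls) auto
    also have "(\<Sum>L\<leftarrow>Ls. complex_of_real (u L i)) = (\<Sum>L\<leftarrow>Ls. ((Z * L) * mat_adjoint (Z * L)) $$ (i, i))"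
    proof (intro arg_cong[of _ _ sum_list] map_cong refl)
      fix L assume "L \<in> set Ls"
      then have "Z * L \<in> carrier_mat n (dim_col L)" using Ls by (intro mult_carrier_mat[OF Z] carrier_matI) auto
      from mult_adjoint_diag[OF this i]
      show "complex_of_real (u L i) = ((Z * L) * mat_adjoint (Z * L)) $$ (i, i)" unfolding u_def ..
    qed
    also have "\<dots> = (Z * 1\<^sub>m m * mat_adjoint Z) $$ (i, i)"
      unfolding sum_gram_diag[OF Z i Ls] one ..
    also have "\<dots> = complex_of_real (\<Sum>l<m. (cmod (Z $$ (i, l)))\<^sup>2)"
      unfolding right_mult_one_mat[OF Z] by (rule mult_adjoint_diag[OF Z i])
    also have "\<dots> = complex_of_real (c i)"
      unfolding Z_def gram_spectral_row[OF X V i] ..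
    finally show "(\<Sum>L\<leftarrow>Ls. u L i) powr a = c i powr a" by (simp only: of_real_eq_iff)
  qed
  finally show ?thesis unfolding gram_norm_spectral[OF V] .
qed

section \<open>Measurements by either party and complete protocols\<close>

lemma kraus_family_foldr_adjoint:
  "foldr (\<lambda>L S. L * mat_adjoint L + S) (map mat_adjoint Ks) S0 = foldr (\<lambda>K S. mat_adjoint K * K + S) (Ks :: complex mat list) S0"
  by (induction Ks) auto

text \<open>Alice's operators act on the coefficient matrix from the right by their transposes. This
  turns her completeness relation into the form that \<open>gram_norm_superadditive\<close>
  expects.\<close>

lemma kraus_family_foldr_transpose:
  fixes Ks :: "complex mat list"
  assumes "\<forall>K\<in>set Ks. dim_col K = d"
  shows "foldr (\<lambda>L S. L * mat_adjoint L + S) (map transpose_mat Ks) (0\<^sub>m d d)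
    = transpose_mat (foldr (\<lambda>K S. mat_adjoint K * K + S) Ks (0\<^sub>m d d))"
  using assms
proof (induction Ks)
  case (Cons K Ks)
  have K: "dim_col K = d" using Cons by simp
  have "transpose_mat K * mat_adjoint (transpose_mat K) = transpose_mat (mat_adjoint K * K)"
    by (intro eq_matI) (auto simp: scalar_prod_def mult.commute)
  moreover have "foldr (\<lambda>K S. mat_adjoint K * K + S) Ks (0\<^sub>m d d) \<in> carrier_mat d d"
    using foldr_gram_carrier[of "map mat_adjoint Ks" d] Cons.prems by (simp add: kraus_family_foldr_adjoint)
  moreover have "mat_adjoint K * K \<in> carrier_mat d d" using K by auto
  ultimately show ?case using Cons by (simp add: transpose_add[of _ d d])
qed simp

text \<open>Passing to adjoints turns left multiplication by \<open>K\<close> into right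
  multiplication by \<open>mat_adjoint K\<close>, which \<open>gram_norm_superadditive\<close>
  covers.\<close>

lemma gram_norm_kraus_left:
  fixes X :: "complex mat"
  assumes a: "0 < a" "a < 1" and X: "X \<in> carrier_mat n m" and K: "kraus_family n Ks"
  shows "(\<Sum>K\<leftarrow>Ks. gram_norm a (K * X)) \<le> gram_norm a X"
proof -
  have "(\<Sum>L\<leftarrow>map mat_adjoint Ks. gram_norm a (mat_adjoint X * L)) \<le> gram_norm a (mat_adjoint X)"
    using K X by (intro gram_norm_superadditive[of _ _ m n] a) (auto simp: kraus_family_def kraus_family_foldr_adjoint)
  moreover have "gram_norm a (mat_adjoint X * mat_adjoint K) = gram_norm a (K * X)" if "K \<in> set Ks" for K
    using K X that gram_norm_adjoint[of a "K * X"]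
    by (subst (asm) mat_adjoint_mult[of _ "dim_row K" n _ m]) (auto simp: kraus_family_def)
  then have "map (\<lambda>K. gram_norm a (mat_adjoint X * mat_adjoint K)) Ks = map (\<lambda>K. gram_norm a (K * X)) Ks"
    by simp
  ultimately show ?thesis by (simp add: gram_norm_adjoint o_def)
qed

lemma gram_norm_kraus_right:
  fixes X :: "complex mat"
  assumes a: "0 < a" "a < 1" and X: "X \<in> carrier_mat n m" and K: "kraus_family m Ks"
  shows "(\<Sum>K\<leftarrow>Ks. gram_norm a (X * transpose_mat K)) \<le> gram_norm a X"
  using gram_norm_superadditive[OF a X, of "map transpose_mat Ks"] K kraus_family_foldr_transpose[of Ks m]
  by (simp add: kraus_family_def o_def)

lemma outcome_ops_dims:
  assumes "valid_protocol dA dB P" "(A, B) \<in> set (outcome_ops dA dB P)"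
  shows "dim_col A = dA" "dim_col B = dB"
  using assms by (induction dA dB P arbitrary: A B rule: outcome_ops.induct) (fastforce simp: kraus_family_def)+

lemma sum_list_concat_map:
  "sum_list (map f (concat (map g xs))) = (\<Sum>x\<leftarrow>xs. sum_list (map f (g x)))"
  by (induction xs) auto

text \<open>Induction over the decision tree with \<open>X\<close> arbitrary and not normalised:
  after a measurement the unnormalised post-measurement matrix takes the place of \<open>X\<close>,
  so no conditional probabilities appear.\<close>

theorem gram_norm_protocol:
  fixes X :: "complex mat"
  assumes a: "0 < a" "a < 1" and X: "X \<in> carrier_mat dB dA" and P: "valid_protocol dA dB P"
  shows "(\<Sum>(A, B)\<leftarrow>outcome_ops dA dB P. gram_norm a (B * X * transpose_mat A)) \<le> gram_norm a X"
  using X P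
proof (induction dA dB P arbitrary: X rule: outcome_ops.induct)
  case (1 dA dB)
  then show ?case by (simp add: left_mult_one_mat[of _ dB dA] right_mult_one_mat[of _ dB dA])
next
  case (2 dA dB br)
  let ?f = "\<lambda>(A, B). gram_norm a (B * X * transpose_mat A)"
  \<comment> \<open>The outcomes of \<open>X\<close> below the branch \<open>K\<close> are the
    outcomes of the remaining protocol on \<open>X * transpose_mat K\<close>, to which the induction
    hypothesis applies.\<close>
  have step: "sum_list (map ?f (map (\<lambda>(A, B). (A * K, B)) (outcome_ops (dim_row K) dB P)))
      \<le> gram_norm a (X * transpose_mat K)" if KP: "(K, P) \<in> set br" for K P
  proof -
    have K: "dim_col K = dA" and V: "valid_protocol (dim_row K) dB P"
      using 2(3) KP by (auto simp: kraus_family_def)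
    have XK: "X * transpose_mat K \<in> carrier_mat dB (dim_row K)"
      using 2(2) K by (intro mult_carrier_mat[of _ dB dA]) auto
    have "gram_norm a (B * X * transpose_mat (A * K)) = gram_norm a (B * (X * transpose_mat K) * transpose_mat A)"
      if "(A, B) \<in> set (outcome_ops (dim_row K) dB P)" for A B
    proof -
      have A: "A \<in> carrier_mat (dim_row A) (dim_row K)" and B: "B \<in> carrier_mat (dim_row B) dB"
        using outcome_ops_dims[OF V that] by (auto intro: carrier_matI)
      have Kc: "K \<in> carrier_mat (dim_row K) dA" using K by (intro carrier_matI) auto
      have BX: "B * X \<in> carrier_mat (dim_row B) dA" using mult_carrier_mat[OF B 2(2)] .
      have "B * X * transpose_mat (A * K) = B * X * (transpose_mat K * transpose_mat A)"
        using transpose_mult[OF A Kc] by simp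
      also have "\<dots> = B * X * transpose_mat K * transpose_mat A"
        using assoc_mult_mat[OF BX transpose_carrier_mat[THEN iffD2, OF Kc] transpose_carrier_mat[THEN iffD2, OF A]]
        by (rule sym)
      also have "B * X * transpose_mat K = B * (X * transpose_mat K)"
        by (rule assoc_mult_mat[OF B 2(2) transpose_carrier_mat[THEN iffD2, OF Kc]])
      finally show ?thesis by simp
    qed
    then have "map (?f \<circ> (\<lambda>(A, B). (A * K, B))) (outcome_ops (dim_row K) dB P)
      = map (\<lambda>(A, B). gram_norm a (B * (X * transpose_mat K) * transpose_mat A)) (outcome_ops (dim_row K) dB P)"
      by (intro map_cong) auto
    then show ?thesis using 2(1)[OF KP refl XK V] by (simp only: map_map)
  qed
  have "sum_list (map ?f (outcome_ops dA dB (Round Alice br)))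
      \<le> (\<Sum>(K, P)\<leftarrow>br. gram_norm a (X * transpose_mat K))"
    using step unfolding outcome_ops.simps sum_list_concat_map by (intro sum_list_mono) auto
  also have "\<dots> = (\<Sum>K\<leftarrow>map fst br. gram_norm a (X * transpose_mat K))"
    by (intro arg_cong[of _ _ sum_list]) auto
  also have "\<dots> \<le> gram_norm a X" using 2 by (intro gram_norm_kraus_right[OF a]) auto
  finally show ?case .
next
  case (3 dA dB br)
  let ?f = "\<lambda>(A, B). gram_norm a (B * X * transpose_mat A)"
  have step: "sum_list (map ?f (map (\<lambda>(A, B). (A, B * K)) (outcome_ops dA (dim_row K) P)))
      \<le> gram_norm a (K * X)" if KP: "(K, P) \<in> set br" for K P
  proof -
    have K: "dim_col K = dB" and V: "valid_protocol dA (dim_row K) P"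
      using 3(3) KP by (auto simp: kraus_family_def)
    have Kc: "K \<in> carrier_mat (dim_row K) dB" using K by (intro carrier_matI) auto
    have KX: "K * X \<in> carrier_mat (dim_row K) dA"
      using mult_carrier_mat[OF Kc 3(2)] .
    have "gram_norm a (B * K * X * transpose_mat A) = gram_norm a (B * (K * X) * transpose_mat A)"
      if "(A, B) \<in> set (outcome_ops dA (dim_row K) P)" for A B
    proof -
      have B: "B \<in> carrier_mat (dim_row B) (dim_row K)"
        using outcome_ops_dims[OF V that] by (intro carrier_matI) auto
      show ?thesis unfolding assoc_mult_mat[OF B Kc 3(2)] ..
    qed
    then have "map (?f \<circ> (\<lambda>(A, B). (A, B * K))) (outcome_ops dA (dim_row K) P)
      = map (\<lambda>(A, B). gram_norm a (B * (K * X) * transpose_mat A)) (outcome_ops dA (dim_row K) P)"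
      by (intro map_cong) auto
    then show ?thesis using 3(1)[OF KP refl KX V] by (simp only: map_map)
  qed
  have "sum_list (map ?f (outcome_ops dA dB (Round Bob br)))
      \<le> (\<Sum>(K, P)\<leftarrow>br. gram_norm a (K * X))"
    using step unfolding outcome_ops.simps sum_list_concat_map by (intro sum_list_mono) auto
  also have "\<dots> = (\<Sum>K\<leftarrow>map fst br. gram_norm a (K * X))"
    by (intro arg_cong[of _ _ sum_list]) auto
  also have "\<dots> \<le> gram_norm a X" using 3 by (intro gram_norm_kraus_left[OF a]) auto
  finally show ?case .
qed

section \<open>Coefficient matrices of bipartite states\<close>

lemma sum_lessThan_mult:
  fixes f :: "nat \<Rightarrow> 'a :: comm_monoid_add"
  shows "(\<Sum>k<p * q. f k) = (\<Sum>i<p. \<Sum>j<q. f (i * q + j))"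
proof -
  have "(\<Sum>k<p * q. f k) = (\<Sum>i<p. sum f {i * q..<i * q + q})"
    by (rule sum.nat_group[symmetric])
  also have "\<dots> = (\<Sum>i<p. \<Sum>j<q. f (i * q + j))"
  proof (rule sum.cong[OF refl])
    fix i
    show "sum f {i * q..<i * q + q} = (\<Sum>j<q. f (i * q + j))"
      by (rule sum.reindex_bij_witness[of _ "\<lambda>j. i * q + j" "\<lambda>k. k - i * q"]) auto
  qed
  finally show ?thesis .
qed

lemma pair_index_less:
  fixes i j p q :: nat
  assumes "i < p" "j < q"
  shows "i * q + j < p * q"
proof -
  have "i * q + j < Suc i * q" using assms by simp
  also have "\<dots> \<le> p * q" using assms by (intro mult_le_mono1) simp
  finally show ?thesis .
qed

text \<open>Rows belong to Bob, so that \<open>X * mat_adjoint X\<close> is the reduced state of B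
  rather than of A. The flat index follows the convention of \<open>kron\<close>.\<close>

definition coeff_mat :: "nat \<Rightarrow> nat \<Rightarrow> complex vec \<Rightarrow> complex mat" where
  "coeff_mat dA dB \<Phi> = mat dB dA (\<lambda>(b, a). \<Phi> $ (a * dB + b))"

lemma coeff_mat_carrier [simp]: "coeff_mat dA dB \<Phi> \<in> carrier_mat dB dA"
  by (simp add: coeff_mat_def)

lemma coeff_mat_dim [simp]: "dim_row (coeff_mat dA dB \<Phi>) = dB" "dim_col (coeff_mat dA dB \<Phi>) = dA"
  by (simp_all add: coeff_mat_def)

lemma coeff_mat_index [simp]: "b < dB \<Longrightarrow> a < dA \<Longrightarrow> coeff_mat dA dB \<Phi> $$ (b, a) = \<Phi> $ (a * dB + b)"
  by (simp add: coeff_mat_def)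

lemma reduced_B_eq_gram:
  assumes "\<Phi> \<in> carrier_vec (dA * dB)"
  shows "reduced_B dA dB \<Phi> = coeff_mat dA dB \<Phi> * mat_adjoint (coeff_mat dA dB \<Phi>)"
proof (rule eq_matI)
  fix i j assume "i < dim_row (coeff_mat dA dB \<Phi> * mat_adjoint (coeff_mat dA dB \<Phi>))"
    "j < dim_col (coeff_mat dA dB \<Phi> * mat_adjoint (coeff_mat dA dB \<Phi>))"
  then have ij: "i < dB" "j < dB" by auto
  have "(coeff_mat dA dB \<Phi> * mat_adjoint (coeff_mat dA dB \<Phi>)) $$ (i, j)
      = (\<Sum>a<dA. \<Phi> $ (a * dB + i) * cnj (\<Phi> $ (a * dB + j)))"
    using ij by (subst index_mult_mat_sum[of _ dB dA _ dB]) (auto intro!: sum.cong)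
  then show "reduced_B dA dB \<Phi> $$ (i, j) = (coeff_mat dA dB \<Phi> * mat_adjoint (coeff_mat dA dB \<Phi>)) $$ (i, j)"
    using ij assms by (simp add: reduced_B_def ptrace_A_def ketbra_def pair_index_less del: index_mult_mat(1))
qed (auto simp: reduced_B_def ptrace_A_def)

text \<open>Splitting the flat index into \<open>i * dB + j\<close>, with \<open>div\<close> and
  \<open>mod\<close> recovering \<open>i\<close> and \<open>j\<close>, separates the sum into two
  matrix products.\<close>

lemma coeff_mat_kron:
  assumes A: "A \<in> carrier_mat p dA" and B: "B \<in> carrier_mat q dB" and \<Phi>: "\<Phi> \<in> carrier_vec (dA * dB)"
  shows "coeff_mat p q (kron A B *\<^sub>v \<Phi>) = B * coeff_mat dA dB \<Phi> * transpose_mat A"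
proof (rule eq_matI)
  note [simp] = carrier_matD[OF A] carrier_matD[OF B] carrier_vecD[OF \<Phi>]
  let ?X = "coeff_mat dA dB \<Phi>"
  fix b a assume "b < dim_row (B * ?X * transpose_mat A)" "a < dim_col (B * ?X * transpose_mat A)"
  then have b: "b < q" and a: "a < p" by auto
  note ab = pair_index_less[OF a b]
  have BX: "B * ?X \<in> carrier_mat q dA" by (rule mult_carrier_mat[OF B coeff_mat_carrier])
  have "(kron A B *\<^sub>v \<Phi>) $ (a * q + b) = (\<Sum>k<dA * dB. A $$ (a, k div dB) * B $$ (b, k mod dB) * \<Phi> $ k)"
    using ab a b by (simp add: kron_def scalar_prod_def lessThan_atLeast0)
  also have "\<dots> = (\<Sum>i<dA. \<Sum>j<dB. A $$ (a, i) * B $$ (b, j) * \<Phi> $ (i * dB + j))"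
    unfolding sum_lessThan_mult by (intro sum.cong refl) simp
  also have "\<dots> = (\<Sum>i<dA. (\<Sum>j<dB. B $$ (b, j) * ?X $$ (j, i)) * A $$ (a, i))"
    unfolding sum_distrib_right by (intro sum.cong refl) simp
  also have "\<dots> = (\<Sum>i<dA. (B * ?X) $$ (b, i) * transpose_mat A $$ (i, a))"
    using a b by (intro sum.cong refl) (simp add: index_mult_mat_sum[OF B coeff_mat_carrier] del: index_mult_mat(1))
  also have "\<dots> = (B * ?X * transpose_mat A) $$ (b, a)"
    by (rule index_mult_mat_sum[OF BX transpose_carrier_mat[THEN iffD2, OF A] b a, symmetric])
  finally show "coeff_mat p q (kron A B *\<^sub>v \<Phi>) $$ (b, a) = (B * ?X * transpose_mat A) $$ (b, a)"
    using a b by simp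
qed (use A B in simp_all)

lemma vnorm_coeff_mat:
  assumes "\<Phi> \<in> carrier_vec (dA * dB)"
  shows "(vnorm \<Phi>)\<^sup>2 = (\<Sum>b<dB. \<Sum>a<dA. (cmod (coeff_mat dA dB \<Phi> $$ (b, a)))\<^sup>2)"
proof -
  have "\<Phi> \<bullet>c \<Phi> = complex_of_real (\<Sum>k<dA * dB. (cmod (\<Phi> $ k))\<^sup>2)"
    using assms unfolding of_real_sum complex_norm_square
    by (simp add: scalar_prod_def lessThan_atLeast0 conjugate_complex_def)
  then have "(vnorm \<Phi>)\<^sup>2 = (\<Sum>k<dA * dB. (cmod (\<Phi> $ k))\<^sup>2)"
    by (simp add: vnorm_def sum_nonneg del: of_real_sum)
  also have "\<dots> = (\<Sum>b<dB. \<Sum>a<dA. (cmod (coeff_mat dA dB \<Phi> $$ (b, a)))\<^sup>2)"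
    unfolding sum_lessThan_mult by (subst sum.swap) simp
  finally show ?thesis .
qed

lemma coeff_mat_smult:
  assumes "\<Phi> \<in> carrier_vec (dA * dB)"
  shows "coeff_mat dA dB (c \<cdot>\<^sub>v \<Phi>) = c \<cdot>\<^sub>m coeff_mat dA dB \<Phi>"
  using assms by (intro eq_matI) (auto simp: pair_index_less)

section \<open>Entropies of pure states\<close>

lemma pure_state_spectral:
  assumes "pure_state dA dB \<Phi>"
  obtains U d where "spectral dB (reduced_B dA dB \<Phi>) U d" "\<And>i. i < dB \<Longrightarrow> d i \<ge> 0" "(\<Sum>i<dB. d i) = 1"
proof -
  have \<Phi>: "\<Phi> \<in> carrier_vec (dA * dB)" "vnorm \<Phi> = 1" using assms by (auto simp: pure_state_def)
  let ?X = "coeff_mat dA dB \<Phi>"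
  obtain U d where U: "spectral dB (?X * mat_adjoint ?X) U d"
    by (rule gram_spectral_exists[OF coeff_mat_carrier])
  show ?thesis
    using that U gram_spectral_nonneg[OF coeff_mat_carrier U] gram_spectral_sum[OF coeff_mat_carrier U]
      vnorm_coeff_mat[OF \<Phi>(1)] \<Phi>(2) reduced_B_eq_gram[OF \<Phi>(1)] by simp
qed

lemma sum_powr_pos:
  fixes d :: "nat \<Rightarrow> real"
  assumes "\<And>i. i < n \<Longrightarrow> d i \<ge> 0" "(\<Sum>i<n. d i) = 1"
  shows "(\<Sum>i<n. d i powr a) > 0"
proof -
  obtain i where "i < n" "d i \<noteq> 0" using assms(2) by (metis lessThan_iff sum.neutral zero_neq_one)
  then show ?thesis by (intro sum_pos2[of _ i]) auto
qed

text \<open>With \<open>?T\<close> the trace of the \<open>a\<close>-th power of the reduced state,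
  both sides equal \<open>?T powr (1 / a)\<close>. Trace one makes \<open>?T\<close> positive, so
  \<open>exp\<close> undoes \<open>ln\<close>.\<close>

lemma renyi_ee_gram_norm:
  assumes a: "0 < a" "a < 1" and \<Phi>: "pure_state dA dB \<Phi>"
  shows "gram_norm a (coeff_mat dA dB \<Phi>) = exp ((1 - a) / a * renyi_ee a dA dB \<Phi>)"
proof -
  obtain U d where U: "spectral dB (reduced_B dA dB \<Phi>) U d" "\<And>i. i < dB \<Longrightarrow> d i \<ge> 0" "(\<Sum>i<dB. d i) = 1"
    using pure_state_spectral[OF \<Phi>] by metis
  let ?T = "\<Sum>i<dB. d i powr a"
  have T: "?T > 0" by (rule sum_powr_pos[OF U(2,3)])
  have "gram_norm a (coeff_mat dA dB \<Phi>) = ?T powr (1 / a)"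
    using gram_norm_spectral U(1) reduced_B_eq_gram \<Phi> by (simp add: pure_state_def)
  moreover have "renyi_ee a dA dB \<Phi> = 1 / (1 - a) * ln ?T"
    by (simp add: renyi_ee_def mat_trace_mat_fun[OF U(1)])
  ultimately show ?thesis using T a by (simp add: powr_def)
qed

text \<open>A case of the monotonicity of Renyi entropies in their order, comparing order 1 with
  order 1/2.\<close>

lemma ent_entropy_le_renyi_half:
  assumes \<Phi>: "pure_state dA dB \<Phi>"
  shows "ent_entropy dA dB \<Phi> \<le> renyi_ee (1 / 2) dA dB \<Phi>"
proof -
  obtain U d where U: "spectral dB (reduced_B dA dB \<Phi>) U d" "\<And>i. i < dB \<Longrightarrow> d i \<ge> 0" "(\<Sum>i<dB. d i) = 1"
    using pure_state_spectral[OF \<Phi>] by metis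
  define T where "T = (\<Sum>i<dB. d i powr (1 / 2))"
  have T: "T > 0" unfolding T_def by (rule sum_powr_pos[OF U(2,3)])
  \<comment> \<open>The last summand is arranged to add up to \<open>2 * (T / T - 1) = 0\<close>,
    while the first adds up to \<open>2 * ln T\<close>.\<close>
  have "- (d i * ln (d i)) \<le> 2 * ln T * d i + 2 * (d i powr (1 / 2) / T - d i)" if i: "i < dB" for i
  proof (cases "d i = 0")
    case False
    then have d: "d i > 0" using U(2)[OF i] by simp
    \<comment> \<open>Jensen's inequality for \<open>ln\<close> via its tangent: the weights are \<open>d\<^sub>i\<close>, the points \<open>1 / sqrt d\<^sub>i\<close>, their mean is \<open>T\<close>\<close>
    have "ln (1 / (sqrt (d i) * T)) \<le> 1 / (sqrt (d i) * T) - 1"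
      using d T by (intro ln_le_minus_one) auto
    then have "- (ln (d i) / 2) - ln T \<le> 1 / (sqrt (d i) * T) - 1"
      using d T by (simp add: ln_div ln_mult ln_sqrt)
    then have "2 * d i * (- (ln (d i) / 2) - ln T) \<le> 2 * d i * (1 / (sqrt (d i) * T) - 1)"
      using d by (intro mult_left_mono) auto
    also have "2 * d i * (1 / (sqrt (d i) * T) - 1) = 2 * (d i / sqrt (d i) / T - d i)"
      by (simp add: right_diff_distrib)
    also have "d i / sqrt (d i) = d i powr (1 / 2)" using d by (simp add: real_div_sqrt powr_half_sqrt)
    finally show ?thesis by (simp add: right_diff_distrib mult_ac)
  qed simp
  then have "(\<Sum>i<dB. - (d i * ln (d i))) \<le> (\<Sum>i<dB. 2 * ln T * d i + 2 * (d i powr (1 / 2) / T - d i))"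
    by (intro sum_mono) auto
  also have "\<dots> = 2 * ln T * (\<Sum>i<dB. d i) + 2 * (T / T - (\<Sum>i<dB. d i))"
    by (simp add: sum.distrib sum_subtractf T_def flip: sum_distrib_left sum_divide_distrib)
  also have "\<dots> = 2 * ln T" using U(3) T by simp
  also have "(\<Sum>i<dB. - (d i * ln (d i))) = ent_entropy dA dB \<Phi>"
    by (simp add: ent_entropy_def mat_trace_mult_mat_fun[OF U(1)] sum_negf)
  also have "2 * ln T = renyi_ee (1 / 2) dA dB \<Phi>"
    by (simp add: renyi_ee_def mat_trace_mat_fun[OF U(1)] T_def)
  finally show ?thesis .
qed

section \<open>Tail bounds\<close>

lemma kron_mult_carrier:
  "kron A B *\<^sub>v \<Phi> \<in> carrier_vec (dim_row A * dim_row B)"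
  by (rule carrier_vecI) (simp add: kron_def)

lemma outcome_state_pure:
  assumes "outcome_prob \<Psi> (A, B) > 0"
  shows "pure_state (dim_row A) (dim_row B) (outcome_state \<Psi> (A, B))"
proof -
  let ?v = "kron A B *\<^sub>v \<Psi>" and ?p = "outcome_prob \<Psi> (A, B)"
  have v: "?v \<in> carrier_vec (dim_row A * dim_row B)" by (rule kron_mult_carrier)
  have [simp]: "dim_row (kron A B) = dim_row A * dim_row B" by (simp add: kron_def)
  have c: "outcome_state \<Psi> (A, B) \<in> carrier_vec (dim_row A * dim_row B)"
    unfolding outcome_state_def prod.case by (rule smult_carrier_vec[THEN iffD2, OF v])
  have "(vnorm (outcome_state \<Psi> (A, B)))\<^sup>2 = (1 / sqrt ?p)\<^sup>2 * (vnorm ?v)\<^sup>2"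
    unfolding vnorm_coeff_mat[OF c] vnorm_coeff_mat[OF v] sum_distrib_left
    using v assms by (intro sum.cong refl) (simp add: outcome_state_def pair_index_less norm_mult norm_divide power_mult_distrib power_divide)
  also have "\<dots> = 1" using assms by (simp add: power_divide outcome_prob_def)
  finally have "(vnorm (outcome_state \<Psi> (A, B)))\<^sup>2 = 1" .
  moreover have "vnorm (outcome_state \<Psi> (A, B)) \<ge> 0"
    using conjugate_square_ge_0_vec[of "outcome_state \<Psi> (A, B)"] by (simp add: vnorm_def less_eq_complex_def)
  ultimately have "vnorm (outcome_state \<Psi> (A, B)) = 1"
    by (auto simp: power2_eq_1_iff)
  then show ?thesis using c by (simp add: pure_state_def)
qed

text \<open>The normalisation \<open>1 / sqrt p\<close> of the outcome state enters squared, so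
  weighting with the probability \<open>p\<close> cancels it.\<close>

lemma outcome_gram_norm:
  assumes a: "0 < a" and p: "outcome_prob \<Psi> (A, B) > 0"
    and \<Psi>: "\<Psi> \<in> carrier_vec (dA * dB)" and dims: "dim_col A = dA" "dim_col B = dB"
  shows "outcome_prob \<Psi> (A, B) * gram_norm a (coeff_mat (dim_row A) (dim_row B) (outcome_state \<Psi> (A, B)))
    = gram_norm a (B * coeff_mat dA dB \<Psi> * transpose_mat A)"
proof -
  have "A \<in> carrier_mat (dim_row A) dA" "B \<in> carrier_mat (dim_row B) dB"
    using dims by (auto intro: carrier_matI)
  from coeff_mat_kron[OF this \<Psi>] show ?thesis
    using p gram_norm_scale[OF a, of "1 / sqrt (outcome_prob \<Psi> (A, B))"]
    by (simp add: outcome_state_def coeff_mat_smult[OF kron_mult_carrier] power_divide)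
qed

text \<open>Markov's inequality for \<open>gram_norm\<close> of the outcome states. It is stated for
  every real \<open>x\<close> because the second part of the main theorem uses it at
  \<open>x - c\<close>, which may be negative.\<close>

theorem prob_gain_renyi_le:
  assumes a: "0 < a" "a < 1" and \<Psi>: "pure_state dA dB \<Psi>" and P: "valid_protocol dA dB P"
  shows "prob_gain (renyi_ee a) dA dB P \<Psi> x \<le> exp (- ((1 - a) / a) * x)"
proof -
  define ops where "ops = outcome_ops dA dB P"
  define N where "N = gram_norm a (coeff_mat dA dB \<Psi>)"
  define p where "p m = outcome_prob \<Psi> (ops ! m)" for m
  define E where "E m = renyi_ee a (dim_row (fst (ops ! m))) (dim_row (snd (ops ! m))) (outcome_state \<Psi> (ops ! m))" for m
  define g where "g m = (case ops ! m of (A, B) \<Rightarrow> gram_norm a (B * coeff_mat dA dB \<Psi> * transpose_mat A))" for m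
  define E0 where "E0 = renyi_ee a dA dB \<Psi>"
  define r where "r = (1 - a) / a"
  have r: "r > 0" using a by (simp add: r_def)
  have g0: "g m \<ge> 0" for m by (simp add: g_def gram_norm_def split: prod.split)
  have pg: "p m * exp (r * E m) = g m" if "m < length ops" "p m > 0" for m
  proof -
    obtain A B where AB: "ops ! m = (A, B)" by fastforce
    have "(A, B) \<in> set (outcome_ops dA dB P)" using that(1) AB nth_mem unfolding ops_def by metis
    from outcome_ops_dims[OF P this] show ?thesis
      using that outcome_gram_norm[OF a(1), of \<Psi> A B dA dB] \<Psi> renyi_ee_gram_norm[OF a outcome_state_pure, of \<Psi> A B]
      by (simp add: p_def E_def g_def AB r_def pure_state_def)
  qed
  have N: "N = exp (r * E0)" unfolding N_def r_def E0_def by (rule renyi_ee_gram_norm[OF a \<Psi>])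
  let ?S = "{m. m < length ops \<and> p m > 0 \<and> E m - E0 \<ge> x}"
  have "(\<Sum>m\<in>?S. p m) \<le> (\<Sum>m\<in>?S. g m * exp (- r * (E0 + x)))"
  proof (intro sum_mono)
    fix m assume m: "m \<in> ?S"
    then have "p m * exp (r * (E0 + x)) \<le> g m"
      using r pg[of m, symmetric] by (auto intro!: mult_left_mono)
    then have "p m * exp (r * (E0 + x)) * exp (- r * (E0 + x)) \<le> g m * exp (- r * (E0 + x))"
      by (intro mult_right_mono) auto
    then show "p m \<le> g m * exp (- r * (E0 + x))" by (simp add: mult.assoc flip: exp_add)
  qed
  \<comment> \<open>Since \<open>g\<close> is nonnegative, the sum may be extended from the event to
    all outcomes, including those of probability zero.\<close>
  also have "\<dots> \<le> (\<Sum>m<length ops. g m * exp (- r * (E0 + x)))"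
    using g0 by (intro sum_mono2) auto
  also have "\<dots> = (\<Sum>m<length ops. g m) * exp (- r * (E0 + x))" by (simp add: sum_distrib_right)
  also have "(\<Sum>m<length ops. g m) = (\<Sum>(A, B)\<leftarrow>ops. gram_norm a (B * coeff_mat dA dB \<Psi> * transpose_mat A))"
    by (simp add: sum_list_sum_nth g_def lessThan_atLeast0)
  also have "\<dots> * exp (- r * (E0 + x)) \<le> N * exp (- r * (E0 + x))"
    unfolding ops_def N_def by (intro mult_right_mono gram_norm_protocol[OF a coeff_mat_carrier P]) auto
  also have "\<dots> = exp (- r * x)" unfolding N by (simp add: algebra_simps flip: exp_add)
  finally show ?thesis
    by (simp add: prob_gain_def Let_def ops_def p_def E_def E0_def r_def)
qed

theorem mainTheorem4:
  fixes dA dB :: nat and \<Psi> :: "complex vec"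
  assumes "pure_state dA dB \<Psi>"
  shows "(\<forall>\<alpha>::real. 0 < \<alpha> \<and> \<alpha> < 1 \<longrightarrow>
           (\<forall>P x. valid_protocol dA dB P \<and> x \<ge> 0 \<longrightarrow>
              prob_gain (renyi_ee \<alpha>) dA dB P \<Psi> x \<le> exp (- ((1 - \<alpha>) / \<alpha>) * x)))
       \<and> (\<exists>K>0. \<exists>k>0. \<forall>P x. valid_protocol dA dB P \<and> x \<ge> 0 \<longrightarrow>
              prob_gain ent_entropy dA dB P \<Psi> x \<le> K * exp (- k * x))"
proof (rule conjI)
  show "\<forall>\<alpha>::real. 0 < \<alpha> \<and> \<alpha> < 1 \<longrightarrow>
           (\<forall>P x. valid_protocol dA dB P \<and> x \<ge> 0 \<longrightarrow>
              prob_gain (renyi_ee \<alpha>) dA dB P \<Psi> x \<le> exp (- ((1 - \<alpha>) / \<alpha>) * x))"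
    using prob_gain_renyi_le[OF _ _ assms] by blast
next
  \<comment> \<open>The entropy gap of the initial state. As \<open>ent_entropy\<close> is at most
    \<open>renyi_ee (1 / 2)\<close> on every outcome state, a gain of \<open>x\<close> in the former
    forces a gain of at least \<open>x - c\<close> in the latter.\<close>
  define c where "c = renyi_ee (1 / 2) dA dB \<Psi> - ent_entropy dA dB \<Psi>"
  have "prob_gain ent_entropy dA dB P \<Psi> x \<le> exp c * exp (- 1 * x)" if P: "valid_protocol dA dB P" for P x
  proof -
    have le: "ent_entropy (dim_row (fst o')) (dim_row (snd o')) (outcome_state \<Psi> o')
        \<le> renyi_ee (1 / 2) (dim_row (fst o')) (dim_row (snd o')) (outcome_state \<Psi> o')"
      if "outcome_prob \<Psi> o' > 0" for o'
      using that outcome_state_pure[of \<Psi> "fst o'" "snd o'"] by (intro ent_entropy_le_renyi_half) simp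
    have "prob_gain ent_entropy dA dB P \<Psi> x \<le> prob_gain (renyi_ee (1 / 2)) dA dB P \<Psi> (x - c)"
      unfolding prob_gain_def Let_def
    proof (intro sum_mono2 subsetI)
      fix m assume "m \<in> {m. m < length (outcome_ops dA dB P) \<and> 0 < outcome_prob \<Psi> (outcome_ops dA dB P ! m) \<and>
         x \<le> ent_entropy (dim_row (fst (outcome_ops dA dB P ! m))) (dim_row (snd (outcome_ops dA dB P ! m)))
            (outcome_state \<Psi> (outcome_ops dA dB P ! m)) - ent_entropy dA dB \<Psi>}"
      then show "m \<in> {m. m < length (outcome_ops dA dB P) \<and> 0 < outcome_prob \<Psi> (outcome_ops dA dB P ! m) \<and>
         x - c \<le> renyi_ee (1 / 2) (dim_row (fst (outcome_ops dA dB P ! m))) (dim_row (snd (outcome_ops dA dB P ! m)))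
            (outcome_state \<Psi> (outcome_ops dA dB P ! m)) - renyi_ee (1 / 2) dA dB \<Psi>}"
        using le[of "outcome_ops dA dB P ! m"] by (simp add: c_def)
    qed auto
    \<comment> \<open>At order 1/2 the decay rate is 1, which gives \<open>k = 1\<close>; the shift
      by \<open>c\<close> becomes the prefactor \<open>exp c\<close>.\<close>
    also have "\<dots> \<le> exp (- ((1 - 1 / 2) / (1 / 2)) * (x - c))"
      by (rule prob_gain_renyi_le[OF _ _ assms P]) auto
    also have "\<dots> = exp c * exp (- 1 * x)" by (simp flip: exp_add)
    finally show ?thesis .
  qed
  then show "\<exists>K>0. \<exists>k>0. \<forall>P x. valid_protocol dA dB P \<and> x \<ge> 0 \<longrightarrow>
              prob_gain ent_entropy dA dB P \<Psi> x \<le> K * exp (- k * x)"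
    by (intro exI[of _ "exp c"] exI[of _ 1] conjI) auto
qed

end
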